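(* Let $0\le\gamma<1$, $p\in(0,2]$, and let $\Lambda:[0,1]\to[0,1]$ be any function. Let $\varphi=\{\varphi_n(r)\}_{n=0}^\infty\in\mathcal{F}$, let $R_\gamma(p)$ be the minimal positive root in $(0,1)$ of the equation $$\frac{2}{p}\sum_{n=1}^{\infty}\varphi_n(r)=(1+\gamma)\varphi_0(r),$$ and assume that $(1+\gamma)\varphi_0(r)>\frac{2}{p}\sum_{n=1}^\infty\varphi_n(r)$ for $0\le r<R_\gamma(p)$. Let $f$ be analytic in $\Omega_\gamma$ with $|f(z)|\le 1$ for $z\in\Omega_\gamma$, and let $f(z)=\sum_{n=0}^\infty a_nz^n$ be its power series in $\mathbb{D}$. Then for $0\le r\le R_\gamma(p)$, $$\mathcal{M}^{\Lambda(r)}_f(\varphi(r),p,\gamma):=\varphi_0(r)|a_0|^p+\sum_{n=1}^\infty|a_n|\varphi_n(r)+\Lambda(r)\,\mathcal{A}(f_0,\varphi,r)\le\varphi_0(r).$$ Moreover, if $(1+\gamma)\varphi_0(r)<\frac{2}{p}\sum_{n=1}^\infty\varphi_n(r)$ for all $r$ in some interval $(R_\gamma(p),R_\gamma(p)+\epsilon)$, then the number $R_\gamma(p)$ cannot be improved: for each $r$ in that interval there is a function $f$ analytic in $\Omega_\gamma$ with $|f|\le1$ there for which $\mathcal{M}^{\Lambda(r)}_f(\varphi(r),p,\gamma)>\varphi_0(r)$.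
   Context: For $0\le\gamma<1$, $\Omega_\gamma:=\{z\in\mathbb{C}: |z+\frac{\gamma}{1-\gamma}|<\frac{1}{1-\gamma}\}$; it is a disk containing the unit disk $\mathbb{D}=\{|z|<1\}$. $\mathcal{F}$ denotes the set of all sequences $\{\varphi_n(r)\}_{n=0}^\infty$ of non-negative continuous functions on $[0,1)$ such that $\sum_{n=0}^\infty\varphi_n(r)$ converges locally uniformly on $[0,1)$. For $N\ge0$, $\Phi_N(r):=\sum_{n=N}^\infty\varphi_n(r)$. For $f(z)=\sum_{n\ge0}a_nz^n$ in $\mathbb{D}$, $f_0(z):=f(z)-f(0)$ and $$\mathcal{A}(f_0,\varphi,r):=\sum_{n=1}^\infty|a_n|^{2n}\left(\frac{\varphi_{2n}(r)}{1+|a_0|}+\Phi_{2n+1}(r)\right).$$ *)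

theory Defs
  imports "HOL-Analysis.Analysis"
begin

definition Omega :: "real \<Rightarrow> complex set" where
  "Omega \<gamma> = ball (complex_of_real (- \<gamma> / (1 - \<gamma>))) (1 / (1 - \<gamma>))"

definition in_F :: "(nat \<Rightarrow> real \<Rightarrow> real) \<Rightarrow> bool" where
  "in_F \<phi> \<longleftrightarrow>
     (\<forall>n. continuous_on {0..<1} (\<phi> n) \<and> (\<forall>r\<in>{0..<1}. 0 \<le> \<phi> n r)) \<and>
     (\<forall>K. compact K \<and> K \<subseteq> {0..<1} \<longrightarrow>
        uniform_limit K (\<lambda>N r. \<Sum>n<N. \<phi> n r) (\<lambda>r. \<Sum>n. \<phi> n r) sequentially)"

definition PhiT :: "(nat \<Rightarrow> real \<Rightarrow> real) \<Rightarrow> nat \<Rightarrow> real \<Rightarrow> real" where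
  "PhiT \<phi> N r = (\<Sum>k. \<phi> (k + N) r)"

definition A_fun :: "(nat \<Rightarrow> complex) \<Rightarrow> (nat \<Rightarrow> real \<Rightarrow> real) \<Rightarrow> real \<Rightarrow> real" where
  "A_fun a \<phi> r = (\<Sum>m. let n = Suc m in
      norm (a n) ^ (2 * n) * (\<phi> (2 * n) r / (1 + norm (a 0)) + PhiT \<phi> (2 * n + 1) r))"

text \<open>M_f^{Lambda(r)}(phi(r), p, gamma) (the formula does not depend on gamma).\<close>
definition Mf :: "(real \<Rightarrow> real) \<Rightarrow> (nat \<Rightarrow> complex) \<Rightarrow> (nat \<Rightarrow> real \<Rightarrow> real) \<Rightarrow> real \<Rightarrow> real \<Rightarrow> real" where
  "Mf \<Lambda> a \<phi> p r = \<phi> 0 r * norm (a 0) powr p + (\<Sum>m. norm (a (Suc m)) * \<phi> (Suc m) r)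
      + \<Lambda> r * A_fun a \<phi> r"

end

(* The substitution w = gamma + (1 - gamma) z maps Omega gamma onto the unit disk; put g w = f z.
   On |w| = 1 let u_i = 1 / cnj z ^ i. In the Hardy space whose measure represents evaluation at gamma,
   the adjoint of multiplication by g maps u_i to sum_{j <= i} cnj (a_j) u_{i-j}, so
   n_i = |u_i|^2 - |g^* u_i|^2 depends on the a_j only; rewriting |w| = 1 in terms of z gives
   n_0 = (1 - |a_0|^2) / (1 + gamma) and n_i <= n_{i-1} - |a_i|^2.
   Integrating |x|^2 + |y|^2 + 2 Re (g x cnj y) >= 0 for suitable sums x, y of an analytic and an
   antianalytic function yields the Cauchy-Schwarz inequality |a_{2m+1}| <= n_m; replacing u_m by
   u_m + s u_0 and optimising s yields |a_{2m}| <= n_{m-1} - |a_m|^2 / (1 + |a_0|).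
   These bounds, multiplied by phi_k and summed over k, give
   sum |a_k| phi_k + A <= (1 - |a_0|^2) / (1 + gamma) sum_{k >= 1} phi_k, and
   p/2 (1 - x^2) <= 1 - x^p concludes. For sharpness take Moebius maps of Omega gamma onto the
   unit disk with a_0 = x and let x tend to 1. *)

theory Submission
  imports Defs "HOL-Complex_Analysis.Complex_Analysis"
begin

text \<open>Where |g| <= 1, the Hermitian 2x2 matrix with diagonal entries 1 and off-diagonal
  entries \<open>g\<close> and its conjugate is positive semidefinite. Tested on an analytic plus an
  antianalytic direction it has two defects on its diagonal and a Hankel entry off it; for the
  powers i and j of \<open>beta\<close> that entry is the Taylor coefficient of index i + j + 1. So
  a_k is controlled by defects at about half its index, and the defect at m has already lost
  |a_1|^2, ..., |a_m|^2. This is the room for the terms that the functional attaches to phi_k: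
  |a_n|^(2n) for 2n < k, and the same over 1 + |a_0| for 2n = k.

  The obstacle is \<open>\<gamma>\<close> > 0. The boundary circle is not centred at z = 0, so
  \<open>beta\<close> has no constant modulus on it and multiplication by \<open>beta\<close> is not
  an isometry. The failure is exactly a term \<open>\<gamma>\<close> |beta v - v|^2, which has a
  favourable sign for defects. Moreover the power series of f need not converge on that circle, so
  only Taylor polynomials with a holomorphic remainder are used.\<close>

(* (1 - gamma^2) / |1 - gamma w|^2 is the Poisson kernel at gamma: the weight has total mass 1 / (1 + gamma). *)
definition smean :: "real \<Rightarrow> (complex \<Rightarrow> real) \<Rightarrow> real" where
  "smean \<gamma> F = integral {0..1}
     (\<lambda>t. (1 - \<gamma>) / (cmod (1 - \<gamma> * cis (2 * pi * t)))\<^sup>2 * F (cis (2 * pi * t)))"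

definition blaschke :: "real \<Rightarrow> complex \<Rightarrow> complex" where
  "blaschke \<gamma> w = (w - \<gamma>) / (1 - \<gamma> * w)"

(* On the unit circle this is the inverse of cnj (disk_coord gamma w), see disk_coord_cnj_beta. *)
definition beta :: "real \<Rightarrow> complex \<Rightarrow> complex" where
  "beta \<gamma> w = (1 - \<gamma>) * w / (1 - \<gamma> * w)"

definition disk_coord :: "real \<Rightarrow> complex \<Rightarrow> complex" where
  "disk_coord \<gamma> w = (w - \<gamma>) / (1 - \<gamma>)"

(* X is the image of u under the adjoint of multiplication by g: multiples of the Blaschke factor
   with holomorphic cofactor integrate to 0. *)
definition adjoint_pair :: "real \<Rightarrow> (complex \<Rightarrow> complex) \<Rightarrow> (complex \<Rightarrow> complex) \<Rightarrow> (complex \<Rightarrow> complex) \<Rightarrow> bool" where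
  "adjoint_pair \<gamma> g u X \<longleftrightarrow> u holomorphic_on cball 0 1 \<and> X holomorphic_on cball 0 1 \<and>
     (\<exists>e. e holomorphic_on cball 0 1 \<and>
       (\<forall>w\<in>sphere 0 1. g w * cnj (u w) - cnj (X w) = blaschke \<gamma> w * e w))"

section \<open>Poisson means and identities on the unit circle\<close>

context
  fixes \<gamma> :: real
  assumes \<gamma>0: "0 \<le> \<gamma>" and \<gamma>1: "\<gamma> < 1"
begin

lemma one_minus_mult_nz: "w \<in> cball 0 1 \<Longrightarrow> 1 - of_real \<gamma> * (w::complex) \<noteq> 0"
proof
  assume w: "w \<in> cball 0 1" and e: "1 - of_real \<gamma> * w = 0"
  then have "cmod (of_real \<gamma> * w) = 1" by (metis eq_iff_diff_eq_0 norm_one)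
  then have "\<gamma> * cmod w = 1" using \<gamma>0 by (simp add: norm_mult)
  moreover have "\<gamma> * cmod w \<le> \<gamma> * 1" using w \<gamma>0 by (intro mult_left_mono) auto
  ultimately show False using \<gamma>1 by simp
qed

lemma smean_integrable:
  assumes "continuous_on (sphere 0 1) F"
  shows "(\<lambda>t. (1 - \<gamma>) / (cmod (1 - \<gamma> * cis (2 * pi * t)))\<^sup>2 * F (cis (2 * pi * t)))
    integrable_on {0..1}"
proof (rule integrable_continuous_real)
  have "continuous_on {0..1} (\<lambda>t. F (cis (2 * pi * t)))"
    by (rule continuous_on_compose2[OF assms]) (auto intro!: continuous_intros)
  moreover have "1 - \<gamma> * cis (2 * pi * t) \<noteq> 0" for t
    by (rule one_minus_mult_nz) auto
  ultimately show "continuous_on {0..1} (\<lambda>t. (1 - \<gamma>) / (cmod (1 - \<gamma> * cis (2 * pi * t)))\<^sup>2 * F (cis (2 * pi * t)))"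
    by (auto intro!: continuous_intros)
qed

lemma smean_cong: "(\<And>w. w \<in> sphere 0 1 \<Longrightarrow> F w = G w) \<Longrightarrow> smean \<gamma> F = smean \<gamma> G"
  unfolding smean_def by (intro integral_cong) simp

lemma smean_add:
  assumes "continuous_on (sphere 0 1) F" "continuous_on (sphere 0 1) G"
  shows "smean \<gamma> (\<lambda>w. F w + G w) = smean \<gamma> F + smean \<gamma> G"
  using integral_add[OF assms[THEN smean_integrable]]
  by (simp add: smean_def distrib_left)

lemma smean_scale: "smean \<gamma> (\<lambda>w. c * F w) = c * smean \<gamma> F"
proof -
  have "smean \<gamma> (\<lambda>w. c * F w) = integral {0..1}
     (\<lambda>t. c * ((1 - \<gamma>) / (cmod (1 - \<gamma> * cis (2 * pi * t)))\<^sup>2 * F (cis (2 * pi * t))))"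
    unfolding smean_def by (intro integral_cong) simp
  then show ?thesis by (simp only: smean_def integral_mult_right)
qed

lemma smean_nonneg:
  assumes "continuous_on (sphere 0 1) F" "\<And>w. w \<in> sphere 0 1 \<Longrightarrow> 0 \<le> F w"
  shows "0 \<le> smean \<gamma> F"
  unfolding smean_def using \<gamma>1 assms(2)
  by (intro integral_nonneg smean_integrable[OF assms(1)]) (auto intro!: mult_nonneg_nonneg)

lemma cnj_sphere: "w \<in> sphere 0 1 \<Longrightarrow> cnj w = 1 / (w::complex)"
  by (simp add: divide_conv_cnj)

lemma sphere_nz: "w \<in> sphere 0 1 \<Longrightarrow> w \<noteq> (0::complex)"
  by auto

lemma sphere_ne: "w \<in> sphere 0 1 \<Longrightarrow> w - of_real \<gamma> \<noteq> (0::complex)"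
  using \<gamma>0 \<gamma>1 by auto

text \<open>Cauchy's formula at \<open>\<gamma>\<close> for F w / (1 - \<open>\<gamma>\<close> w).
  On the circle |1 - \<open>\<gamma>\<close> w|^2 = (1 - \<open>\<gamma>\<close> w)(w -
  \<open>\<gamma>\<close>) / w, so the weighted measure is (1 - \<open>\<gamma>\<close>) dw / (2 pi
  i (1 - \<open>\<gamma>\<close> w)(w - \<open>\<gamma>\<close>)); the factor 1 / (1 +
  \<open>\<gamma>\<close>) is (1 - \<open>\<gamma>\<close>) / (1 - \<open>\<gamma>\<close>^2). Every
  mean below that is evaluated explicitly reduces to this one.\<close>

lemma smean_Re_holo:
  assumes F: "F holomorphic_on cball 0 1"
  shows "smean \<gamma> (\<lambda>w. Re (F w)) = Re (F \<gamma>) / (1 + \<gamma>)"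
proof -
  define G where "G w = F w / (1 - \<gamma> * w)" for w :: complex
  have "G holomorphic_on cball 0 1"
    unfolding G_def using one_minus_mult_nz by (intro holomorphic_intros F) auto
  from Cauchy_integral_circlepath_simple[OF this, of "of_real \<gamma>"]
  have "((\<lambda>u. G u / (u - \<gamma>)) has_contour_integral 2 * of_real pi * \<i> * G \<gamma>) (circlepath 0 1)"
    using \<gamma>0 \<gamma>1 by simp
  then have "((\<lambda>t. G (circlepath 0 1 t) / (circlepath 0 1 t - \<gamma>) * vector_derivative (circlepath 0 1) (at t))
     has_integral 2 * of_real pi * \<i> * G \<gamma>) {0..1}"
    unfolding has_contour_integral .
  moreover have "circlepath 0 1 t = cis (2 * pi * t)"
      "vector_derivative (circlepath 0 1) (at t) = 2 * pi * \<i> * cis (2 * pi * t)" for t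
    unfolding vector_derivative_circlepath by (simp_all add: circlepath cis_conv_exp mult_ac)
  ultimately have 0: "((\<lambda>t. G (cis (2*pi*t)) / (cis (2*pi*t) - \<gamma>) * (2 * pi * \<i> * cis (2*pi*t)))
     has_integral 2 * of_real pi * \<i> * G \<gamma>) {0..1}"
    by (simp only:)
  define K :: complex where "K = 2 * of_real pi * \<i>"
  have K: "K \<noteq> 0" by (simp add: K_def)
  have "((\<lambda>t. G (cis (2*pi*t)) / (cis (2*pi*t) - \<gamma>) * (K * cis (2*pi*t)))
     has_integral K * G \<gamma>) {0..1}" using 0 by (simp add: K_def)
  from has_integral_mult_right[OF this, of "(1-\<gamma>) / K"]
  have 1: "((\<lambda>t. (1-\<gamma>) / K * (G (cis (2*pi*t)) / (cis (2*pi*t) - \<gamma>) * (K * cis (2*pi*t))))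
     has_integral (1-\<gamma>) / K * (K * G \<gamma>)) {0..1}" .
  have r: "(1-\<gamma>) / K * (K * G \<gamma>) = F \<gamma> / (1 + \<gamma>)"
  proof -
    have "(1 - \<gamma>) * G \<gamma> = F \<gamma> / (1 + \<gamma>)"
    proof -
      have "1 - of_real \<gamma> * of_real \<gamma> = (1 - of_real \<gamma>) * (1 + of_real \<gamma> :: complex)" by (simp add: algebra_simps)
      moreover have "1 - of_real \<gamma> \<noteq> (0::complex)" using \<gamma>1 by (metis less_irrefl of_real_1 of_real_eq_iff right_minus_eq)
      ultimately show ?thesis unfolding G_def by simp
    qed
    then show ?thesis using K by simp
  qed
  have i: "(1-\<gamma>) / K * (G w / (w - \<gamma>) * (K * w))
      = of_real ((1 - \<gamma>) / (cmod (1 - \<gamma> * w))\<^sup>2) * F w" if w: "w \<in> sphere 0 1" for w :: complex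
  proof -
    have "of_real ((cmod (1 - \<gamma> * w))\<^sup>2) = (1 - \<gamma> * w) * (1 - \<gamma> / w)"
      unfolding complex_norm_square by (simp add: cnj_sphere[OF w])
    also have "\<dots> = (1 - \<gamma> * w) * (w - \<gamma>) / w" using sphere_nz[OF w] by (simp add: field_simps)
    finally have *: "of_real ((cmod (1 - \<gamma> * w))\<^sup>2) = (1 - \<gamma> * w) * (w - \<gamma>) / w" .
    show ?thesis unfolding of_real_divide * G_def using K by simp
  qed
  have "((\<lambda>t. of_real ((1 - \<gamma>) / (cmod (1 - \<gamma> * cis (2*pi*t)))\<^sup>2) * F (cis (2*pi*t)))
     has_integral F \<gamma> / (1 + \<gamma>)) {0..1}"
    using 1 unfolding r by (rule has_integral_eq[rotated]) (rule i, simp)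
  from has_integral_Re[OF this]
  have "((\<lambda>t. (1 - \<gamma>) / (cmod (1 - \<gamma> * cis (2*pi*t)))\<^sup>2 * Re (F (cis (2*pi*t))))
     has_integral Re (F \<gamma> / (1 + \<gamma>))) {0..1}" by (simp add: Re_divide_of_real flip: of_real_mult of_real_divide)
  moreover have "Re (F \<gamma> / (1 + \<gamma>)) = Re (F \<gamma>) / (1 + \<gamma>)"
    using Re_divide_of_real[of "F \<gamma>" "1+\<gamma>"] by simp
  ultimately show ?thesis unfolding smean_def by (simp add: integral_unique)
qed

lemma blaschke_holo [holomorphic_intros]: "blaschke \<gamma> holomorphic_on cball 0 1"
  unfolding blaschke_def using one_minus_mult_nz by (intro holomorphic_intros) auto

lemma beta_holo [holomorphic_intros]: "beta \<gamma> holomorphic_on cball 0 1"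
  unfolding beta_def using one_minus_mult_nz by (intro holomorphic_intros) auto

lemma disk_coord_holo [holomorphic_intros]: "disk_coord \<gamma> holomorphic_on A"
  unfolding disk_coord_def using \<gamma>1 by (intro holomorphic_intros) (auto simp: complex_eq_iff)

lemma blaschke_0: "blaschke \<gamma> \<gamma> = 0" "disk_coord \<gamma> \<gamma> = 0"
  by (auto simp: blaschke_def disk_coord_def)

lemma one_minus_nz: "1 - of_real \<gamma> \<noteq> (0::complex)"
  using \<gamma>1 by (auto simp: complex_eq_iff)

lemma blaschke_beta: fixes w :: complex shows "w \<in> cball 0 1 \<Longrightarrow> blaschke \<gamma> w = (1 + \<gamma>) * beta \<gamma> w - \<gamma>"
  using one_minus_mult_nz[of w] by (simp add: blaschke_def beta_def field_simps)

lemma disk_coord_blaschke: fixes w :: complex shows "w \<in> cball 0 1 \<Longrightarrow> disk_coord \<gamma> w = blaschke \<gamma> w * ((1 - \<gamma> * w) / (1 - \<gamma>))"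
  using one_minus_mult_nz[of w] one_minus_nz by (simp add: blaschke_def disk_coord_def)

lemma blaschke_cnj:
  assumes "w \<in> sphere 0 1"
  shows "blaschke \<gamma> w * cnj (blaschke \<gamma> w) = 1"
proof -
  have "w * (1 / w - \<gamma>) = 1 - \<gamma> * w" "w * (1 - \<gamma> * (1 / w)) = w - \<gamma>"
    using sphere_nz[OF assms] by (auto simp: field_simps)
  then have "cnj (blaschke \<gamma> w) = (1 - \<gamma> * w) / (w - \<gamma>)"
    using sphere_nz[OF assms] unfolding blaschke_def
    by (metis cnj_sphere[OF assms] complex_cnj_complex_of_real complex_cnj_diff complex_cnj_divide
        complex_cnj_mult complex_cnj_one mult_divide_mult_cancel_left)
  then show ?thesis
    using one_minus_mult_nz[of w] sphere_ne[OF assms] assms by (simp add: blaschke_def)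
qed

lemma disk_coord_cnj_beta:
  assumes "w \<in> sphere 0 1"
  shows "disk_coord \<gamma> w * cnj (beta \<gamma> w) = 1"
proof -
  have "w * (1 - \<gamma> * (1 / w)) = w - \<gamma>" "w * ((1 - \<gamma>) * (1 / w)) = 1 - \<gamma>"
    using sphere_nz[OF assms] by (auto simp: field_simps)
  then have "(w * ((1 - \<gamma>) * (1 / w))) / (w * (1 - \<gamma> * (1 / w))) = (1 - \<gamma>) / (w - \<gamma>)"
    by (simp only:)
  moreover have "cnj (beta \<gamma> w) = (of_real (1 - \<gamma>) * (1 / w)) / (1 - \<gamma> * (1 / w))"
    by (simp add: beta_def cnj_sphere[OF assms])
  ultimately have "cnj (beta \<gamma> w) = of_real (1 - \<gamma>) / (w - \<gamma>)"
    by (metis mult_divide_mult_cancel_left sphere_nz[OF assms])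
  then show ?thesis
    using one_minus_nz sphere_ne[OF assms] by (simp add: disk_coord_def)
qed

lemma disk_coord_cnj_blaschke: fixes w :: complex shows "w \<in> sphere 0 1 \<Longrightarrow> disk_coord \<gamma> w * cnj (blaschke \<gamma> w) = (1 - \<gamma> * w) / (1 - \<gamma>)"
  using blaschke_cnj[of w] disk_coord_blaschke[of w] by (simp add: mult_ac)

end

section \<open>Defects and the positive form\<close>

text \<open>For an adjoint pair this is the quadratic form of I - M M^* at \<open>u\<close>, where M
  is multiplication by \<open>g\<close> on the Hardy space.\<close>

definition defect :: "real \<Rightarrow> (complex \<Rightarrow> complex) \<Rightarrow> (complex \<Rightarrow> complex) \<Rightarrow> real" where
  "defect \<gamma> u X = smean \<gamma> (\<lambda>w. (cmod (u w))\<^sup>2 - (cmod (X w))\<^sup>2)"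

lemma holomorphic_continuous_sphere: "F holomorphic_on cball 0 1 \<Longrightarrow> continuous_on (sphere 0 1) F"
  by (rule continuous_on_subset[OF holomorphic_on_imp_continuous_on]) auto

lemma adjoint_pair_diff:
  assumes "adjoint_pair \<gamma> g u X" "adjoint_pair \<gamma> g v Y"
  shows "adjoint_pair \<gamma> g (\<lambda>w. u w - v w) (\<lambda>w. X w - Y w)"
proof -
  obtain e e' where e: "e holomorphic_on cball 0 1" "\<And>w. w \<in> sphere 0 1 \<Longrightarrow> g w * cnj (u w) - cnj (X w) = blaschke \<gamma> w * e w"
    and e': "e' holomorphic_on cball 0 1" "\<And>w. w \<in> sphere 0 1 \<Longrightarrow> g w * cnj (v w) - cnj (Y w) = blaschke \<gamma> w * e' w"
    using assms unfolding adjoint_pair_def by blast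
  have "g w * cnj (u w - v w) - cnj (X w - Y w) = blaschke \<gamma> w * (e w - e' w)"
    if "w \<in> sphere 0 1" for w
    using e(2)[OF that] e'(2)[OF that] by (simp add: algebra_simps)
  moreover have "(\<lambda>w. e w - e' w) holomorphic_on cball 0 1"
    by (intro holomorphic_intros e e')
  ultimately show ?thesis
    using assms unfolding adjoint_pair_def by (auto intro!: holomorphic_intros)
qed

lemma adjoint_pair_add_scale:
  assumes "adjoint_pair \<gamma> g u X" "adjoint_pair \<gamma> g v Y"
  shows "adjoint_pair \<gamma> g (\<lambda>w. u w + s * v w) (\<lambda>w. X w + s * Y w)"
proof -
  obtain e e' where e: "e holomorphic_on cball 0 1" "\<And>w. w \<in> sphere 0 1 \<Longrightarrow> g w * cnj (u w) - cnj (X w) = blaschke \<gamma> w * e w"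
    and e': "e' holomorphic_on cball 0 1" "\<And>w. w \<in> sphere 0 1 \<Longrightarrow> g w * cnj (v w) - cnj (Y w) = blaschke \<gamma> w * e' w"
    using assms unfolding adjoint_pair_def by blast
  have "g w * cnj (u w + s * v w) - cnj (X w + s * Y w) = blaschke \<gamma> w * (e w + cnj s * e' w)"
    if "w \<in> sphere 0 1" for w
  proof -
    have "g w * cnj (u w + s * v w) - cnj (X w + s * Y w) =
        (g w * cnj (u w) - cnj (X w)) + cnj s * (g w * cnj (v w) - cnj (Y w))"
      by (simp add: algebra_simps)
    then show ?thesis using e(2)[OF that] e'(2)[OF that] by (simp add: algebra_simps)
  qed
  moreover have "(\<lambda>w. e w + cnj s * e' w) holomorphic_on cball 0 1"
    by (intro holomorphic_intros e e')
  ultimately show ?thesis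
    using assms unfolding adjoint_pair_def by (auto intro!: holomorphic_intros)
qed

(* All cross terms other than the one in g * cnj (b * v) * cnj u are multiples of the Blaschke factor b. *)
lemma form_pointwise:
  fixes u X v Y b g \<tau> e e' :: complex
  assumes b: "b * cnj b = 1"
    and 1: "g * cnj u - cnj X = b * e" and 2: "g * cnj v - cnj Y = b * e'"
  defines "x \<equiv> - X + \<tau> * cnj (b * v)" and "y \<equiv> u - \<tau> * cnj (b * Y)"
  shows "(cmod x)\<^sup>2 + (cmod y)\<^sup>2 + 2 * Re (g * x * cnj y) =
    ((cmod u)\<^sup>2 - (cmod X)\<^sup>2) + (cmod \<tau>)\<^sup>2 * ((cmod v)\<^sup>2 - (cmod Y)\<^sup>2)
     + 2 * Re (\<tau> * (g * cnj (b * v) * cnj u))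
     + Re (b * (2 * (- (cnj \<tau> * X * v) - cnj \<tau> * u * Y + cnj \<tau> * g * X * Y - X * e
                   - \<tau> * cnj \<tau> * e' * Y)))"
proof -
  have n: "(cmod (p + q))\<^sup>2 = (cmod p)\<^sup>2 + (cmod q)\<^sup>2 + 2 * Re (p * cnj q)" for p q
    unfolding cmod_power2 by (simp add: power2_eq_square algebra_simps)
  have nb: "cmod b = 1"
  proof -
    have "(cmod b)\<^sup>2 = 1" using b by (metis complex_norm_square of_real_eq_1_iff)
    then show ?thesis using norm_ge_zero[of b] by (auto simp: power2_eq_1_iff)
  qed
  have x: "(cmod x)\<^sup>2 = (cmod X)\<^sup>2 + (cmod \<tau>)\<^sup>2 * (cmod v)\<^sup>2 - 2 * Re (cnj \<tau> * b * v * X)"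
    unfolding x_def n by (simp add: norm_mult nb power_mult_distrib) (simp add: algebra_simps)
  have y: "(cmod y)\<^sup>2 = (cmod u)\<^sup>2 + (cmod \<tau>)\<^sup>2 * (cmod Y)\<^sup>2 - 2 * Re (cnj \<tau> * b * Y * u)"
    using n[of u "- (\<tau> * cnj (b * Y))"] unfolding y_def
    by (simp add: norm_mult nb power_mult_distrib) (simp add: algebra_simps)
  have gu: "g * cnj u = cnj X + b * e" and gv: "g * cnj v = cnj Y + b * e'"
    using 1 2 by (simp_all add: algebra_simps)
  have "g * x * cnj y = - X * (g * cnj u) + cnj \<tau> * g * X * b * Y + \<tau> * (g * cnj (b * v) * cnj u)
      - \<tau> * cnj \<tau> * (b * cnj b) * (g * cnj v) * Y"
    unfolding x_def y_def by (simp add: algebra_simps)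
  also have "\<dots> = - (X * cnj X) - \<tau> * cnj \<tau> * (Y * cnj Y) + \<tau> * (g * cnj (b * v) * cnj u)
      + b * (cnj \<tau> * g * X * Y - X * e - \<tau> * cnj \<tau> * e' * Y)"
    unfolding gu gv b by (simp add: algebra_simps)
  finally have "g * x * cnj y = of_real (- (cmod X)\<^sup>2 - (cmod \<tau>)\<^sup>2 * (cmod Y)\<^sup>2) + \<tau> * (g * cnj (b * v) * cnj u)
      + b * (cnj \<tau> * g * X * Y - X * e - \<tau> * cnj \<tau> * e' * Y)"
    unfolding of_real_diff of_real_minus of_real_mult complex_norm_square by simp
  then have g: "Re (g * x * cnj y) = - (cmod X)\<^sup>2 - (cmod \<tau>)\<^sup>2 * (cmod Y)\<^sup>2 + Re (\<tau> * (g * cnj (b * v) * cnj u))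
      + Re (b * (cnj \<tau> * g * X * Y - X * e - \<tau> * cnj \<tau> * e' * Y))"
    by (simp only: plus_complex.sel Re_complex_of_real)
  have split: "Re (b * (2 * (- (cnj \<tau> * X * v) - cnj \<tau> * u * Y + cnj \<tau> * g * X * Y - X * e
                   - \<tau> * cnj \<tau> * e' * Y))) = - 2 * Re (cnj \<tau> * b * v * X) - 2 * Re (cnj \<tau> * b * Y * u)
       + 2 * Re (b * (cnj \<tau> * g * X * Y - X * e - \<tau> * cnj \<tau> * e' * Y))"
  proof -
    have "b * (2 * (- (cnj \<tau> * X * v) - cnj \<tau> * u * Y + cnj \<tau> * g * X * Y - X * e - \<tau> * cnj \<tau> * e' * Y))
      = of_real (-2) * (cnj \<tau> * b * v * X) + of_real (-2) * (cnj \<tau> * b * Y * u)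
        + of_real 2 * (b * (cnj \<tau> * g * X * Y - X * e - \<tau> * cnj \<tau> * e' * Y))"
      by (simp add: algebra_simps)
    moreover have "Re (of_real r * z) = r * Re z" for r z by simp
    ultimately show ?thesis by (simp only: plus_complex.sel)
  qed
  show ?thesis unfolding x y g split by (simp add: algebra_simps)
qed

lemma form_nonneg:
  fixes x y g :: complex
  assumes "cmod g \<le> 1"
  shows "0 \<le> (cmod x)\<^sup>2 + (cmod y)\<^sup>2 + 2 * Re (g * x * cnj y)"
proof -
  have "\<bar>Re (g * x * cnj y)\<bar> \<le> cmod (g * x * cnj y)" by (rule abs_Re_le_cmod)
  also have "\<dots> = cmod g * (cmod x * cmod y)" by (simp add: norm_mult)
  also have "\<dots> \<le> cmod x * cmod y" using assms by (simp add: mult_left_le_one_le)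
  finally show ?thesis using sum_squares_bound[of "cmod x" "cmod y"] by simp
qed

text \<open>Taking \<tau> = -x * \<open>cnj c\<close> with x real makes the cross term real and
  negative for x > 0. For q > 0 the minimum is at x = 1/q; for q = 0 the choice x = (p + 1) / |c|^2
  gives a negative value unless c = 0.\<close>

lemma discriminant_bound:
  fixes c :: complex and p q :: real
  assumes "\<And>\<tau>::complex. 0 \<le> p + (cmod \<tau>)\<^sup>2 * q + 2 * Re (\<tau> * c)" and q: "0 \<le> q"
  shows "(cmod c)\<^sup>2 \<le> p * q"
proof -
  have *: "0 \<le> p + x\<^sup>2 * (cmod c)\<^sup>2 * q - 2 * x * (cmod c)\<^sup>2" for x :: real
  proof -
    have "of_real (-x) * cnj c * c = of_real (- x * (cmod c)\<^sup>2)"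
      unfolding of_real_mult complex_norm_square by simp
    then have "Re (of_real (-x) * cnj c * c) = - x * (cmod c)\<^sup>2"
      by (simp only: Re_complex_of_real)
    then show ?thesis using assms(1)[of "of_real (-x) * cnj c"]
      by (simp add: norm_mult power_mult_distrib)
  qed
  show ?thesis
  proof (cases "q = 0")
    case True
    have "cmod c = 0"
    proof (rule ccontr)
      assume nz: "cmod c \<noteq> 0"
      then have "(p + 1) / (cmod c)\<^sup>2 * (cmod c)\<^sup>2 = p + 1" by simp
      moreover have "0 \<le> p" using *[of 0] by simp
      ultimately show False using *[of "(p + 1) / (cmod c)\<^sup>2"] True nz by (simp add: mult.assoc)
    qed
    then show ?thesis using True by simp
  next
    case False
    then have "0 < q" using q by simp
    have "0 \<le> p + (1/q)\<^sup>2 * (cmod c)\<^sup>2 * q - 2 * (1/q) * (cmod c)\<^sup>2" by (rule *)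
    also have "\<dots> = p - (cmod c)\<^sup>2 / q" using \<open>0 < q\<close> by (simp add: power2_eq_square)
    finally show ?thesis using \<open>0 < q\<close> by (simp add: field_simps)
  qed
qed

section \<open>Cauchy-Schwarz for adjoint pairs and the shift by \<open>beta\<close>\<close>

context
  fixes \<gamma> :: real and g :: "complex \<Rightarrow> complex"
  assumes \<gamma>0: "0 \<le> \<gamma>" and \<gamma>1: "\<gamma> < 1"
    and g_holo: "g holomorphic_on cball 0 1"
    and g_bound: "\<And>w. w \<in> sphere 0 1 \<Longrightarrow> cmod (g w) \<le> 1"
begin

lemma form_integrated:
  assumes A1: "adjoint_pair \<gamma> g u X" and A2: "adjoint_pair \<gamma> g v Y"
  shows "0 \<le> defect \<gamma> u X + (cmod \<tau>)\<^sup>2 * defect \<gamma> v Y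
     + 2 * smean \<gamma> (\<lambda>w. Re (\<tau> * (g w * cnj (blaschke \<gamma> w * v w) * cnj (u w))))"
proof -
  obtain e e' where e: "e holomorphic_on cball 0 1" "\<And>w. w \<in> sphere 0 1 \<Longrightarrow> g w * cnj (u w) - cnj (X w) = blaschke \<gamma> w * e w"
    and e': "e' holomorphic_on cball 0 1" "\<And>w. w \<in> sphere 0 1 \<Longrightarrow> g w * cnj (v w) - cnj (Y w) = blaschke \<gamma> w * e' w"
    using assms unfolding adjoint_pair_def by blast
  have h: "u holomorphic_on cball 0 1" "X holomorphic_on cball 0 1" "v holomorphic_on cball 0 1" "Y holomorphic_on cball 0 1"
    using assms unfolding adjoint_pair_def by auto
  define H where "H w = blaschke \<gamma> w * (2 * (- (cnj \<tau> * X w * v w) - cnj \<tau> * u w * Y w + cnj \<tau> * g w * X w * Y w - X w * e w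
                   - \<tau> * cnj \<tau> * e' w * Y w))" for w
  have Hh: "H holomorphic_on cball 0 1"
    unfolding H_def by (intro holomorphic_intros h g_holo e(1) e'(1) blaschke_holo \<gamma>0 \<gamma>1)
  \<comment> \<open>The Blaschke factor in \<open>H\<close> vanishes at \<open>\<gamma>\<close>, so
    all remaining cross terms average out.\<close>
  have Hs: "smean \<gamma> (\<lambda>w. Re (H w)) = 0"
    using smean_Re_holo[OF \<gamma>0 \<gamma>1 Hh] by (simp add: H_def blaschke_0[OF \<gamma>0 \<gamma>1])
  note c = h[THEN holomorphic_continuous_sphere] holomorphic_continuous_sphere[OF g_holo] holomorphic_continuous_sphere[OF blaschke_holo[OF \<gamma>0 \<gamma>1]] holomorphic_continuous_sphere[OF Hh]
  define F1 where "F1 w = (cmod (u w))\<^sup>2 - (cmod (X w))\<^sup>2" for w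
  define F2 where "F2 w = (cmod \<tau>)\<^sup>2 * ((cmod (v w))\<^sup>2 - (cmod (Y w))\<^sup>2)" for w
  define F3 where "F3 w = 2 * Re (\<tau> * (g w * cnj (blaschke \<gamma> w * v w) * cnj (u w)))" for w
  have k: "continuous_on (sphere 0 1) F1" "continuous_on (sphere 0 1) F2" "continuous_on (sphere 0 1) F3"
    "continuous_on (sphere 0 1) (\<lambda>w. Re (H w))"
    unfolding F1_def F2_def F3_def by (intro continuous_intros c)+
  have k': "continuous_on (sphere 0 1) (\<lambda>w. F1 w + F2 w)" "continuous_on (sphere 0 1) (\<lambda>w. F1 w + F2 w + F3 w)"
    "continuous_on (sphere 0 1) (\<lambda>w. F1 w + F2 w + F3 w + Re (H w))"
    by (intro continuous_intros k)+
  have "0 \<le> smean \<gamma> (\<lambda>w. F1 w + F2 w + F3 w + Re (H w))"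
  proof (rule smean_nonneg[OF \<gamma>0 \<gamma>1 k'(3)])
    fix w :: complex assume w: "w \<in> sphere 0 1"
    show "0 \<le> F1 w + F2 w + F3 w + Re (H w)"
      using form_pointwise[OF blaschke_cnj[OF \<gamma>0 \<gamma>1 w] e(2)[OF w] e'(2)[OF w], of \<tau>]
        form_nonneg[OF g_bound[OF w], of "- X w + \<tau> * cnj (blaschke \<gamma> w * v w)" "u w - \<tau> * cnj (blaschke \<gamma> w * Y w)"]
      unfolding F1_def F2_def F3_def H_def by linarith
  qed
  also have "\<dots> = smean \<gamma> F1 + smean \<gamma> F2 + smean \<gamma> F3"
    using k k' by (simp add: smean_add[OF \<gamma>0 \<gamma>1] Hs)
  finally show ?thesis
    unfolding F1_def F2_def F3_def smean_scale[OF \<gamma>0 \<gamma>1] defect_def .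
qed

text \<open>The adjoint of multiplication by a function bounded by 1 is a contraction; this is the
  case \<tau> = 0 of the integrated form.\<close>

lemma defect_nonneg: "adjoint_pair \<gamma> g u X \<Longrightarrow> 0 \<le> defect \<gamma> u X"
  using form_integrated[of u X u X 0] by (simp add: smean_def)

text \<open>\<open>c\<close> is the Hankel entry. As \<open>smean\<close> averages real functions
  only, a complex mean is prescribed through the real parts of all its multiples by \<tau>.\<close>

lemma adjoint_pair_Cauchy_Schwarz:
  assumes "adjoint_pair \<gamma> g u X" "adjoint_pair \<gamma> g v Y"
    and "\<And>\<tau>. smean \<gamma> (\<lambda>w. Re (\<tau> * (g w * cnj (blaschke \<gamma> w * v w) * cnj (u w)))) = Re (\<tau> * c)"
  shows "(cmod c)\<^sup>2 \<le> defect \<gamma> u X * defect \<gamma> v Y"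
  using form_integrated[OF assms(1,2)] assms(3)
  by (intro discriminant_bound defect_nonneg[OF assms(2)]) metis

text \<open>The substitute for the isometry of the shift. Since \<open>blaschke\<close> = (1 +
  \<open>\<gamma>\<close>) \<open>beta\<close> - \<open>\<gamma>\<close> has modulus 1 on the
  circle, (1 + \<open>\<gamma>\<close>) |beta|^2 - 2 \<open>\<gamma>\<close> Re beta = 1 -
  \<open>\<gamma>\<close> there, and this makes the coefficients of |v|^2 add up to 1. The terms
  linear in \<open>s\<close> combine to 2 Re (blaschke * v * cnj s), of mean 0, and the constant (1
  + \<open>\<gamma>\<close>) |s|^2 has mean |s|^2.\<close>

lemma smean_shift:
  assumes v: "v holomorphic_on cball 0 1"
  shows "smean \<gamma> (\<lambda>w. (cmod (beta \<gamma> w * v w + s))\<^sup>2)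
     + \<gamma> * smean \<gamma> (\<lambda>w. (cmod (beta \<gamma> w * v w + s - v w))\<^sup>2)
     = smean \<gamma> (\<lambda>w. (cmod (v w))\<^sup>2) + (cmod s)\<^sup>2"
proof -
  define H where "H w = of_real ((1 + \<gamma>) * (cmod s)\<^sup>2) + 2 * (blaschke \<gamma> w * v w * cnj s)" for w
  have Hh: "H holomorphic_on cball 0 1"
    unfolding H_def by (intro holomorphic_intros v blaschke_holo \<gamma>0 \<gamma>1)
  have Hs: "smean \<gamma> (\<lambda>w. Re (H w)) = (cmod s)\<^sup>2"
    using smean_Re_holo[OF \<gamma>0 \<gamma>1 Hh] \<gamma>0 by (simp add: H_def blaschke_0[OF \<gamma>0 \<gamma>1] del: of_real_mult of_real_power)
  note c = holomorphic_continuous_sphere[OF v] holomorphic_continuous_sphere[OF beta_holo[OF \<gamma>0 \<gamma>1]] holomorphic_continuous_sphere[OF Hh]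
  have "smean \<gamma> (\<lambda>w. (cmod (beta \<gamma> w * v w + s))\<^sup>2) + smean \<gamma> (\<lambda>w. \<gamma> * (cmod (beta \<gamma> w * v w + s - v w))\<^sup>2)
     = smean \<gamma> (\<lambda>w. (cmod (beta \<gamma> w * v w + s))\<^sup>2 + \<gamma> * (cmod (beta \<gamma> w * v w + s - v w))\<^sup>2)"
    by (intro smean_add[OF \<gamma>0 \<gamma>1, symmetric] continuous_intros c)
  also have "\<dots> = smean \<gamma> (\<lambda>w. (cmod (v w))\<^sup>2 + Re (H w))"
  proof (rule smean_cong[OF \<gamma>0 \<gamma>1])
    fix w :: complex assume w: "w \<in> sphere 0 1"
    define b where "b = beta \<gamma> w"
    have B: "blaschke \<gamma> w = (1 + \<gamma>) * b - \<gamma>"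
      using blaschke_beta[OF \<gamma>0 \<gamma>1, of w] w by (simp add: b_def)
    have "of_real ((cmod (blaschke \<gamma> w))\<^sup>2) = (1::complex)"
      using blaschke_cnj[OF \<gamma>0 \<gamma>1 w] by (simp only: complex_norm_square)
    then have "(cmod (blaschke \<gamma> w))\<^sup>2 = 1" by (simp only: of_real_eq_1_iff)
    then have "(1+\<gamma>) * ((1 + \<gamma>) * ((Re b)\<^sup>2 + (Im b)\<^sup>2) - 2 * \<gamma> * Re b) = (1 + \<gamma>) * (1 - \<gamma>)"
      unfolding B cmod_power2 by (simp add: power2_eq_square algebra_simps)
    then have b: "(1 + \<gamma>) * ((Re b)\<^sup>2 + (Im b)\<^sup>2) - 2 * \<gamma> * Re b = 1 - \<gamma>"
      using \<gamma>0 by simp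
    have "(cmod (b * v w + s))\<^sup>2 + \<gamma> * (cmod (b * v w + s - v w))\<^sup>2 =
        ((1 + \<gamma>) * ((Re b)\<^sup>2 + (Im b)\<^sup>2) - 2 * \<gamma> * Re b + \<gamma>) * (cmod (v w))\<^sup>2
         + Re (H w)"
      unfolding H_def B cmod_power2 by (simp add: power2_eq_square algebra_simps)
    moreover have "(1 + \<gamma>) * ((Re b)\<^sup>2 + (Im b)\<^sup>2) - 2 * \<gamma> * Re b + \<gamma> = 1"
      using b by simp
    ultimately show "(cmod (beta \<gamma> w * v w + s))\<^sup>2 + \<gamma> * (cmod (beta \<gamma> w * v w + s - v w))\<^sup>2 = (cmod (v w))\<^sup>2 + Re (H w)"
      unfolding b_def by simp
  qed
  also have "\<dots> = smean \<gamma> (\<lambda>w. (cmod (v w))\<^sup>2) + (cmod s)\<^sup>2"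
    unfolding Hs[symmetric] by (intro smean_add[OF \<gamma>0 \<gamma>1] continuous_intros c)
  finally show ?thesis unfolding smean_scale[OF \<gamma>0 \<gamma>1] .
qed

lemma defect_split:
  assumes "u holomorphic_on cball 0 1" "X holomorphic_on cball 0 1"
  shows "defect \<gamma> u X = smean \<gamma> (\<lambda>w. (cmod (u w))\<^sup>2) - smean \<gamma> (\<lambda>w. (cmod (X w))\<^sup>2)"
proof -
  have "smean \<gamma> (\<lambda>w. (cmod (u w))\<^sup>2 + (-1) * (cmod (X w))\<^sup>2) = smean \<gamma> (\<lambda>w. (cmod (u w))\<^sup>2) + smean \<gamma> (\<lambda>w. (-1) * (cmod (X w))\<^sup>2)"
    by (intro smean_add[OF \<gamma>0 \<gamma>1] continuous_intros assms[THEN holomorphic_continuous_sphere])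
  then show ?thesis unfolding smean_scale[OF \<gamma>0 \<gamma>1] defect_def by simp
qed

text \<open>Subtracting \<open>smean_shift\<close> for (Y, c) from the one for (v, s) gives an
  identity between defects. The term with factor \<open>\<gamma>\<close> in it is the defect of the
  difference of the two adjoint pairs, hence nonnegative, and dropping it leaves the
  inequality.\<close>

lemma defect_shift:
  assumes A1: "adjoint_pair \<gamma> g v Y" and A2: "adjoint_pair \<gamma> g (\<lambda>w. beta \<gamma> w * v w + s) (\<lambda>w. beta \<gamma> w * Y w + c)"
  shows "defect \<gamma> (\<lambda>w. beta \<gamma> w * v w + s) (\<lambda>w. beta \<gamma> w * Y w + c)
     \<le> defect \<gamma> v Y + (cmod s)\<^sup>2 - (cmod c)\<^sup>2"
proof -
  have "0 \<le> defect \<gamma> (\<lambda>w. beta \<gamma> w * v w + s - v w) (\<lambda>w. beta \<gamma> w * Y w + c - Y w)"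
    by (intro defect_nonneg adjoint_pair_diff assms)
  then have "0 \<le> \<gamma> * defect \<gamma> (\<lambda>w. beta \<gamma> w * v w + s - v w) (\<lambda>w. beta \<gamma> w * Y w + c - Y w)"
    using \<gamma>0 by simp
  moreover have h: "v holomorphic_on cball 0 1" "Y holomorphic_on cball 0 1"
    using A1 unfolding adjoint_pair_def by auto
  ultimately show ?thesis using smean_shift[OF h(1), of s] smean_shift[OF h(2), of c]
    by (subst (asm) defect_split, (intro holomorphic_intros h \<gamma>0 \<gamma>1)+)
      (subst (1 2) defect_split, (intro holomorphic_intros h \<gamma>0 \<gamma>1)+, simp add: algebra_simps)
qed

lemma smean_const: "smean \<gamma> (\<lambda>w. c) = c / (1 + \<gamma>)"
  using smean_Re_holo[OF \<gamma>0 \<gamma>1, of "\<lambda>w. of_real c"] by simp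

end

section \<open>Coefficient bounds for functions on the closed disk\<close>

definition adjoint_pow :: "real \<Rightarrow> (nat \<Rightarrow> complex) \<Rightarrow> nat \<Rightarrow> complex \<Rightarrow> complex" where
  "adjoint_pow \<gamma> a i w = (\<Sum>j\<le>i. cnj (a j) * beta \<gamma> w ^ (i - j))"

text \<open>Horner's rule: raising the power by one is an affine step of the kind that
  \<open>defect_shift\<close> treats.\<close>

lemma adjoint_pow_Suc: "adjoint_pow \<gamma> a (Suc i) w = beta \<gamma> w * adjoint_pow \<gamma> a i w + cnj (a (Suc i))"
proof -
  have "(\<Sum>j\<le>i. cnj (a j) * beta \<gamma> w ^ (Suc i - j)) = beta \<gamma> w * (\<Sum>j\<le>i. cnj (a j) * beta \<gamma> w ^ (i - j))"
    unfolding sum_distrib_left by (rule sum.cong) (auto simp: Suc_diff_le)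
  then show ?thesis by (simp add: adjoint_pow_def)
qed

(* The extremal choice is |sigma| = |x| / (1 + |z|), with the phase aligning y and sigma * x. *)
lemma even_optimisation:
  fixes x y z :: complex and q :: real
  assumes q: "0 \<le> q"
    and *: "\<And>\<sigma>. (cmod (y + \<sigma> * x))\<^sup>2 \<le> q * (q + (cmod \<sigma>)\<^sup>2 - (cmod (x + \<sigma> * z))\<^sup>2)"
  shows "cmod y + (cmod x)\<^sup>2 / (1 + cmod z) \<le> q"
proof -
  define t where "t = cmod x / (1 + cmod z)"
  have t: "0 \<le> t" "t * (1 + cmod z) = cmod x"
    unfolding t_def by (auto simp: add_nonneg_eq_0_iff intro!: divide_nonneg_nonneg)
  obtain \<sigma> where \<sigma>: "cmod \<sigma> = t" "cmod (y + \<sigma> * x) = cmod y + t * cmod x"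
  proof
    define s where "s = cis (Arg y - Arg x)"
    show "cmod (of_real t * s) = t" using t by (simp add: s_def norm_mult)
    have "y = of_real (cmod y) * cis (Arg y)" "x = of_real (cmod x) * cis (Arg x)"
      using rcis_cmod_Arg by (metis rcis_def)+
    moreover have "s * cis (Arg x) = cis (Arg y)" by (simp add: s_def cis_mult)
    ultimately have "y + of_real t * s * x = of_real (cmod y + t * cmod x) * cis (Arg y)"
      by (metis (no_types, opaque_lifting) distrib_right mult.assoc mult.left_commute of_real_add of_real_mult)
    also have "cmod \<dots> = cmod y + t * cmod x"
      using t by (simp add: norm_mult del: of_real_add of_real_mult)
    finally show "cmod (y + of_real t * s * x) = cmod y + t * cmod x" .
  qed
  \<comment> \<open>t solves t = |x| - t |z|. Hence |x + \<sigma> z| is at least |\<sigma>| and the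
    correction to the second factor q in the hypothesis is at most 0.\<close>
  have "t \<le> cmod (x + \<sigma> * z)"
  proof -
    have "cmod x \<le> cmod (x + \<sigma> * z) + cmod (\<sigma> * z)"
      by (metis add_diff_cancel_right' norm_triangle_ineq4)
    then show ?thesis using t \<sigma> by (simp add: norm_mult algebra_simps)
  qed
  then have "t\<^sup>2 \<le> (cmod (x + \<sigma> * z))\<^sup>2" using t by (intro power_mono)
  then have "q * (q + (cmod \<sigma>)\<^sup>2 - (cmod (x + \<sigma> * z))\<^sup>2) \<le> q * q"
    using q \<sigma> by (intro mult_left_mono) auto
  with *[of \<sigma>] have "(cmod y + t * cmod x)\<^sup>2 \<le> q\<^sup>2"
    unfolding \<sigma>(2) power2_eq_square by linarith
  then have "cmod y + t * cmod x \<le> q" using q by (rule power2_le_imp_le)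
  then show ?thesis by (simp add: t_def power2_eq_square)
qed

context
  fixes \<gamma> :: real and g :: "complex \<Rightarrow> complex" and a :: "nat \<Rightarrow> complex"
  assumes \<gamma>0: "0 \<le> \<gamma>" and \<gamma>1: "\<gamma> < 1"
    and g_holo: "g holomorphic_on cball 0 1"
    and g_bound: "\<And>w. w \<in> sphere 0 1 \<Longrightarrow> cmod (g w) \<le> 1"
    and g_taylor: "\<And>K. \<exists>r. r holomorphic_on cball 0 1 \<and>
      (\<forall>w\<in>cball 0 1. g w = (\<Sum>j\<le>K. a j * disk_coord \<gamma> w ^ j) + disk_coord \<gamma> w ^ Suc K * r w)"
begin

lemma adjoint_pow_holo: "adjoint_pow \<gamma> a i holomorphic_on cball 0 1"
  unfolding adjoint_pow_def by (intro holomorphic_intros beta_holo \<gamma>0 \<gamma>1)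

lemma pow_cancel:
  assumes "w \<in> sphere 0 1" "j \<le> i"
  shows "disk_coord \<gamma> w ^ j * cnj (beta \<gamma> w) ^ i = cnj (beta \<gamma> w) ^ (i - j)"
proof -
  have "cnj (beta \<gamma> w) ^ i = cnj (beta \<gamma> w) ^ j * cnj (beta \<gamma> w) ^ (i - j)"
    using assms(2) by (simp flip: power_add)
  then have "disk_coord \<gamma> w ^ j * cnj (beta \<gamma> w) ^ i = (disk_coord \<gamma> w * cnj (beta \<gamma> w)) ^ j * cnj (beta \<gamma> w) ^ (i - j)"
    by (simp add: power_mult_distrib)
  then show ?thesis using disk_coord_cnj_beta[OF \<gamma>0 \<gamma>1 assms(1)] by simp
qed

text \<open>On the circle \<open>cnj (beta \<gamma> w)\<close> is the inverse of
  \<open>disk_coord \<gamma> w\<close>. Thus the Taylor terms of order at most i become polynomials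
  in \<open>cnj beta\<close>, which form the conjugate of \<open>adjoint_pow\<close>, while the
  remainder of order i + 1 keeps one factor \<open>disk_coord\<close>, a holomorphic multiple of the
  Blaschke factor.\<close>

lemma adjoint_pair_beta_pow: "adjoint_pair \<gamma> g (\<lambda>w. beta \<gamma> w ^ i) (adjoint_pow \<gamma> a i)"
proof -
  obtain r where r: "r holomorphic_on cball 0 1"
    "\<And>w. w\<in>cball 0 1 \<Longrightarrow> g w = (\<Sum>j\<le>i. a j * disk_coord \<gamma> w ^ j) + disk_coord \<gamma> w ^ Suc i * r w"
    using g_taylor by blast
  have "g w * cnj (beta \<gamma> w ^ i) - cnj (adjoint_pow \<gamma> a i w) = blaschke \<gamma> w * ((1 - of_real \<gamma> * w) / (1 - of_real \<gamma>) * r w)"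
    if w: "w \<in> sphere 0 1" for w :: complex
  proof -
    have "(\<Sum>j\<le>i. a j * disk_coord \<gamma> w ^ j) * cnj (beta \<gamma> w) ^ i = (\<Sum>j\<le>i. a j * cnj (beta \<gamma> w) ^ (i - j))"
      unfolding sum_distrib_right by (rule sum.cong) (auto simp: mult.assoc pow_cancel[OF w])
    moreover have "disk_coord \<gamma> w ^ Suc i * r w * cnj (beta \<gamma> w) ^ i = disk_coord \<gamma> w * r w"
      using pow_cancel[OF w, of i i] by (simp add: mult_ac)
    ultimately have "g w * cnj (beta \<gamma> w ^ i) - cnj (adjoint_pow \<gamma> a i w) = disk_coord \<gamma> w * r w"
      using r(2)[of w] w by (simp add: adjoint_pow_def distrib_right)
    then show ?thesis using disk_coord_blaschke[OF \<gamma>0 \<gamma>1, of w] w by simp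
  qed
  moreover have "(\<lambda>w. (1 - of_real \<gamma> * w) / (1 - of_real \<gamma>) * r w) holomorphic_on cball 0 1"
    using one_minus_nz[OF \<gamma>0 \<gamma>1] by (intro holomorphic_intros r(1)) auto
  ultimately show ?thesis
    unfolding adjoint_pair_def using adjoint_pow_holo by (auto intro!: holomorphic_intros beta_holo \<gamma>0 \<gamma>1)
qed

text \<open>A coefficient formula with \<open>beta\<close> in place of the usual powers. Orders up
  to N give the conjugate of a holomorphic function vanishing at \<open>\<gamma>\<close>, which has
  the same real part as that function; orders above N + 1 keep a factor \<open>disk_coord\<close>,
  also vanishing at \<open>\<gamma>\<close>. Only order N + 1 contributes.\<close>

lemma smean_coeff:
  "smean \<gamma> (\<lambda>w. Re (\<tau> * (g w * cnj (blaschke \<gamma> w * beta \<gamma> w ^ N)))) = Re (\<tau> * a (Suc N))"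
proof -
  obtain r where r: "r holomorphic_on cball 0 1"
    "\<And>w. w\<in>cball 0 1 \<Longrightarrow> g w = (\<Sum>j\<le>Suc N. a j * disk_coord \<gamma> w ^ j) + disk_coord \<gamma> w ^ Suc (Suc N) * r w"
    using g_taylor by blast
  define l where "l w = (1 - \<gamma> * w) / (1 - \<gamma>)" for w :: complex
  define H where "H w = blaschke \<gamma> w * (\<Sum>j\<le>N. cnj (\<tau> * a j) * beta \<gamma> w ^ (N - j))
     + \<tau> * a (Suc N) * l w + \<tau> * disk_coord \<gamma> w * l w * r w" for w
  have lh: "l holomorphic_on cball 0 1"
    unfolding l_def using one_minus_nz[OF \<gamma>0 \<gamma>1] by (intro holomorphic_intros) auto
  have Hh: "H holomorphic_on cball 0 1"
    unfolding H_def by (intro holomorphic_intros r(1) lh blaschke_holo beta_holo disk_coord_holo \<gamma>0 \<gamma>1)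
  \<comment> \<open>This value cancels the total mass 1 / (1 + \<open>\<gamma>\<close>) of the
    weight, so the coefficient comes out without a constant.\<close>
  have l: "l \<gamma> = 1 + \<gamma>"
  proof -
    have "1 - of_real \<gamma> * of_real \<gamma> = (1 - of_real \<gamma>) * (1 + of_real \<gamma> :: complex)"
      by (simp add: algebra_simps)
    then show ?thesis unfolding l_def using one_minus_nz[OF \<gamma>0 \<gamma>1] by simp
  qed
  have "H \<gamma> = of_real (1 + \<gamma>) * (\<tau> * a (Suc N))"
    unfolding H_def l blaschke_0[OF \<gamma>0 \<gamma>1] by simp
  then have "Re (H \<gamma>) = (1 + \<gamma>) * Re (\<tau> * a (Suc N))"
    by simp
  then have Hs: "smean \<gamma> (\<lambda>w. Re (H w)) = Re (\<tau> * a (Suc N))"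
    using smean_Re_holo[OF \<gamma>0 \<gamma>1 Hh] \<gamma>0 by simp
  have "Re (\<tau> * (g w * cnj (blaschke \<gamma> w * beta \<gamma> w ^ N))) = Re (H w)" if w: "w \<in> sphere 0 1" for w
  proof -
    define S where "S = (\<Sum>j\<le>N. a j * cnj (beta \<gamma> w) ^ (N - j))"
    have lw: "disk_coord \<gamma> w * cnj (blaschke \<gamma> w) = l w"
      unfolding l_def by (rule disk_coord_cnj_blaschke[OF \<gamma>0 \<gamma>1 w])
    have 1: "(\<Sum>j\<le>N. a j * disk_coord \<gamma> w ^ j) * cnj (beta \<gamma> w) ^ N = S"
      unfolding S_def sum_distrib_right by (rule sum.cong) (auto simp: mult.assoc pow_cancel[OF w])
    have 2: "disk_coord \<gamma> w ^ N * cnj (beta \<gamma> w) ^ N = 1"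
      using pow_cancel[OF w, of N N] by simp
    have "g w * cnj (blaschke \<gamma> w * beta \<gamma> w ^ N) =
       cnj (blaschke \<gamma> w) * ((\<Sum>j\<le>N. a j * disk_coord \<gamma> w ^ j) * cnj (beta \<gamma> w) ^ N)
       + a (Suc N) * (disk_coord \<gamma> w * cnj (blaschke \<gamma> w)) * (disk_coord \<gamma> w ^ N * cnj (beta \<gamma> w) ^ N)
       + disk_coord \<gamma> w * (disk_coord \<gamma> w * cnj (blaschke \<gamma> w)) * r w * (disk_coord \<gamma> w ^ N * cnj (beta \<gamma> w) ^ N)"
      using r(2)[of w] w by (simp add: algebra_simps)
    also have "\<dots> = cnj (blaschke \<gamma> w) * S + a (Suc N) * l w + disk_coord \<gamma> w * l w * r w"
      unfolding 1 2 lw by simp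
    finally have "\<tau> * (g w * cnj (blaschke \<gamma> w * beta \<gamma> w ^ N))
      = cnj (blaschke \<gamma> w * cnj (\<tau> * S)) + \<tau> * a (Suc N) * l w + \<tau> * disk_coord \<gamma> w * l w * r w"
      by (simp add: algebra_simps)
    moreover have "cnj (\<tau> * S) = (\<Sum>j\<le>N. cnj (\<tau> * a j) * beta \<gamma> w ^ (N - j))"
      unfolding S_def by (simp add: sum_distrib_left mult_ac)
    ultimately show ?thesis unfolding H_def by (simp only: plus_complex.sel cnj.sel)
  qed
  then show ?thesis unfolding Hs[symmetric] by (rule smean_cong[OF \<gamma>0 \<gamma>1])
qed

definition coeff_defect :: "nat \<Rightarrow> real" where
  "coeff_defect i = defect \<gamma> (\<lambda>w. beta \<gamma> w ^ i) (adjoint_pow \<gamma> a i)"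

lemma coeff_defect_nonneg: "0 \<le> coeff_defect i"
  unfolding coeff_defect_def by (rule defect_nonneg[OF \<gamma>0 \<gamma>1 g_holo g_bound adjoint_pair_beta_pow])

lemma coeff_defect_le:
  "coeff_defect m \<le> (1 - (cmod (a 0))\<^sup>2) / (1 + \<gamma>) - (\<Sum>n=1..m. (cmod (a n))\<^sup>2)"
proof (induction m)
  case 0
  then show ?case
    using smean_const[OF \<gamma>0 \<gamma>1, of g "1 - (cmod (a 0))\<^sup>2"] g_holo g_bound
    by (simp add: coeff_defect_def defect_def adjoint_pow_def)
next
  case (Suc m)
  \<comment> \<open>The summand 0 exhibits the next power as a shift with s = 0, so only the
    constant \<open>cnj (a (Suc m))\<close> on the adjoint side changes the bound.\<close>
  have "(\<lambda>w. beta \<gamma> w * beta \<gamma> w ^ m + 0) = (\<lambda>w. beta \<gamma> w ^ Suc m)" by simp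
  moreover have "(\<lambda>w. beta \<gamma> w * adjoint_pow \<gamma> a m w + cnj (a (Suc m))) = adjoint_pow \<gamma> a (Suc m)"
    by (simp add: adjoint_pow_Suc fun_eq_iff)
  ultimately have "coeff_defect (Suc m) \<le> coeff_defect m + (cmod 0)\<^sup>2 - (cmod (cnj (a (Suc m))))\<^sup>2"
    unfolding coeff_defect_def
    using defect_shift[OF \<gamma>0 \<gamma>1 g_holo g_bound adjoint_pair_beta_pow, of m 0 "cnj (a (Suc m))"] adjoint_pair_beta_pow[of "Suc m"]
    by metis
  then show ?case using Suc by simp
qed

text \<open>Both directions are the m-th power of \<open>beta\<close>, so the two defects coincide
  and the Hankel entry has index 2m + 1.\<close>

lemma odd_coeff_le: "cmod (a (2 * m + 1)) \<le> coeff_defect m"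
proof -
  have "(cmod (a (2 * m + 1)))\<^sup>2 \<le> coeff_defect m * coeff_defect m"
    unfolding coeff_defect_def
  proof (rule adjoint_pair_Cauchy_Schwarz[OF \<gamma>0 \<gamma>1 g_holo g_bound adjoint_pair_beta_pow adjoint_pair_beta_pow])
    fix \<tau>
    have "g w * cnj (blaschke \<gamma> w * beta \<gamma> w ^ m) * cnj (beta \<gamma> w ^ m)
       = g w * cnj (blaschke \<gamma> w * beta \<gamma> w ^ (2 * m))" for w
      by (simp add: mult_2 mult_2_right power_add mult_ac)
    then show "smean \<gamma> (\<lambda>w. Re (\<tau> * (g w * cnj (blaschke \<gamma> w * beta \<gamma> w ^ m) * cnj (beta \<gamma> w ^ m)))) =
          Re (\<tau> * a (2 * m + 1))"
      using smean_coeff[of \<tau> "2 * m"] by (simp only: Suc_eq_plus1)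
  qed
  then show ?thesis using coeff_defect_nonneg[of m] power2_le_imp_le[of "cmod (a (2 * m + 1))" "coeff_defect m"]
    by (simp add: power2_eq_square)
qed

text \<open>An even index forces two different powers, k + 1 and k. Adding a constant to the higher
  power leaves its defect within reach of \<open>coeff_defect k\<close> by
  \<open>defect_shift\<close> and adds a multiple of a_{k+1} to the Hankel entry; the free constant
  is then optimised.\<close>

lemma even_coeff_le: "cmod (a (2 * Suc k)) + (cmod (a (Suc k)))\<^sup>2 / (1 + cmod (a 0)) \<le> coeff_defect k"
proof (rule even_optimisation[OF coeff_defect_nonneg])
  fix \<sigma>
  \<comment> \<open>\<sigma> enters conjugated because \<open>u\<close> occurs conjugated in the
    Hankel entry, which then becomes a_{2k+2} + \<sigma> a_{k+1}.\<close>
  define u where "u w = beta \<gamma> w ^ Suc k + cnj \<sigma> * beta \<gamma> w ^ 0" for w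
  define X where "X w = adjoint_pow \<gamma> a (Suc k) w + cnj \<sigma> * adjoint_pow \<gamma> a 0 w" for w
  have A: "adjoint_pair \<gamma> g u X"
    unfolding u_def X_def by (intro adjoint_pair_add_scale adjoint_pair_beta_pow)
  have u: "u = (\<lambda>w. beta \<gamma> w * beta \<gamma> w ^ k + cnj \<sigma>)"
    and X: "X = (\<lambda>w. beta \<gamma> w * adjoint_pow \<gamma> a k w + cnj (a (Suc k) + \<sigma> * a 0))"
    by (auto simp: u_def X_def adjoint_pow_Suc fun_eq_iff) (simp add: adjoint_pow_def)
  have "defect \<gamma> u X \<le> coeff_defect k + (cmod (cnj \<sigma>))\<^sup>2 - (cmod (cnj (a (Suc k) + \<sigma> * a 0)))\<^sup>2"
    unfolding coeff_defect_def u X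
    by (rule defect_shift[OF \<gamma>0 \<gamma>1 g_holo g_bound adjoint_pair_beta_pow]) (use A in \<open>simp_all only: u X\<close>)
  then have d: "defect \<gamma> u X \<le> coeff_defect k + (cmod \<sigma>)\<^sup>2 - (cmod (a (Suc k) + \<sigma> * a 0))\<^sup>2"
    by (simp only: complex_mod_cnj)
  have "(cmod (a (2 * Suc k) + \<sigma> * a (Suc k)))\<^sup>2 \<le> defect \<gamma> u X * coeff_defect k"
    unfolding coeff_defect_def
  proof (rule adjoint_pair_Cauchy_Schwarz[OF \<gamma>0 \<gamma>1 g_holo g_bound A adjoint_pair_beta_pow])
    fix \<tau>
    define F G where "F w = Re (\<tau> * (g w * cnj (blaschke \<gamma> w * beta \<gamma> w ^ (2 * k + 1))))"
      and "G w = Re ((\<tau> * \<sigma>) * (g w * cnj (blaschke \<gamma> w * beta \<gamma> w ^ k)))" for w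
    note c = holomorphic_continuous_sphere[OF g_holo] holomorphic_continuous_sphere[OF blaschke_holo[OF \<gamma>0 \<gamma>1]] holomorphic_continuous_sphere[OF beta_holo[OF \<gamma>0 \<gamma>1]]
    have "smean \<gamma> (\<lambda>w. F w + G w) = smean \<gamma> F + smean \<gamma> G"
      unfolding F_def G_def by (intro smean_add[OF \<gamma>0 \<gamma>1] continuous_intros c)
    also have "\<dots> = Re (\<tau> * a (2 * Suc k)) + Re (\<tau> * \<sigma> * a (Suc k))"
      unfolding F_def G_def smean_coeff by simp
    also have "\<dots> = Re (\<tau> * (a (2 * Suc k) + \<sigma> * a (Suc k)))"
      by (simp add: algebra_simps)
    finally have "smean \<gamma> (\<lambda>w. F w + G w) = Re (\<tau> * (a (2 * Suc k) + \<sigma> * a (Suc k)))" .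
    moreover have "F w + G w = Re (\<tau> * (g w * cnj (blaschke \<gamma> w * beta \<gamma> w ^ k) * cnj (u w)))" for w
    proof -
      have "\<tau> * (g w * cnj (blaschke \<gamma> w * beta \<gamma> w ^ k) * cnj (u w)) =
        \<tau> * (g w * cnj (blaschke \<gamma> w * beta \<gamma> w ^ (2 * k + 1)))
        + (\<tau> * \<sigma>) * (g w * cnj (blaschke \<gamma> w * beta \<gamma> w ^ k))"
        unfolding u by (simp add: mult_2 mult_2_right power_add algebra_simps)
      then show ?thesis unfolding F_def G_def by (simp only: plus_complex.sel)
    qed
    ultimately show "smean \<gamma> (\<lambda>w. Re (\<tau> * (g w * cnj (blaschke \<gamma> w * beta \<gamma> w ^ k) * cnj (u w)))) =
          Re (\<tau> * (a (2 * Suc k) + \<sigma> * a (Suc k)))" by (simp only:)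
  qed
  also have "\<dots> \<le> (coeff_defect k + (cmod \<sigma>)\<^sup>2 - (cmod (a (Suc k) + \<sigma> * a 0))\<^sup>2) * coeff_defect k"
    by (intro mult_right_mono d coeff_defect_nonneg)
  finally show "(cmod (a (2 * Suc k) + \<sigma> * a (Suc k)))\<^sup>2
     \<le> coeff_defect k * (coeff_defect k + (cmod \<sigma>)\<^sup>2 - (cmod (a (Suc k) + \<sigma> * a 0))\<^sup>2)"
    by (simp only: mult.commute)
qed

lemma coeff_bounds_disk:
  "cmod (a (2 * m + 1)) + (\<Sum>n=1..m. (cmod (a n))\<^sup>2) \<le> (1 - (cmod (a 0))\<^sup>2) / (1 + \<gamma>)"
  "cmod (a (2 * m + 2)) + (\<Sum>n=1..m. (cmod (a n))\<^sup>2) + (cmod (a (m + 1)))\<^sup>2 / (1 + cmod (a 0))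
     \<le> (1 - (cmod (a 0))\<^sup>2) / (1 + \<gamma>)"
  using coeff_defect_le[of m] odd_coeff_le[of m] even_coeff_le[of m] by simp_all

end

section \<open>From the closed disk to \<open>Omega\<close>: Taylor remainders and dilation\<close>

text \<open>The remainder is a quotient away from 0 and a power series on the unit disk; the two
  open sets cover S, so it is holomorphic on all of S although the series is known to converge only
  on the unit disk.\<close>

lemma taylor_division_step:
  assumes S: "open S" "ball 0 1 \<subseteq> S" and f: "f holomorphic_on S"
    and s: "\<And>z. z \<in> ball 0 1 \<Longrightarrow> (\<lambda>n. a n * z ^ n) sums f z"
  obtains r where "r holomorphic_on S" "\<And>z. z \<in> S \<Longrightarrow> f z = a 0 + z * r z"
    "\<And>z. z \<in> ball 0 1 \<Longrightarrow> (\<lambda>n. a (Suc n) * z ^ n) sums r z"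
proof -
  define r where "r z = (if z = 0 then a 1 else (f z - a 0) / z)" for z
  have f0: "f 0 = a 0"
    using s[of 0] by (simp add: powser_sums_zero_iff)
  have rs: "(\<lambda>n. a (Suc n) * z ^ n) sums r z" if "z \<in> ball 0 1" for z
  proof (cases "z = 0")
    case True
    then show ?thesis using powser_sums_zero_iff[of "\<lambda>n. a (Suc n)"] by (simp add: r_def)
  next
    case False
    have "(\<lambda>n. a (Suc n) * z ^ Suc n) sums (f z - a 0)"
      using s[OF that] sums_Suc_iff[of "\<lambda>n. a n * z ^ n" "f z - a 0"] by simp
    from sums_divide[OF this, of z] show ?thesis using False by (simp add: r_def)
  qed
  have "r holomorphic_on (S - {0})"
  proof -
    have "(\<lambda>z. (f z - a 0) / z) holomorphic_on (S - {0})"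
      by (intro holomorphic_intros holomorphic_on_subset[OF f]) auto
    then show ?thesis by (rule holomorphic_transform) (auto simp: r_def)
  qed
  moreover have "r holomorphic_on ball 0 1"
    by (rule power_series_holomorphic[where a = "\<lambda>n. a (Suc n)"]) (use rs in simp)
  ultimately have "r holomorphic_on ((S - {0}) \<union> ball 0 1)"
    using S by (intro holomorphic_on_Un) auto
  moreover have "(S - {0}) \<union> ball 0 1 = S" using S by auto
  ultimately show thesis
    using that[of r] rs f0 by (auto simp: r_def)
qed

lemma taylor_division:
  assumes S: "open S" "ball 0 1 \<subseteq> S" and f: "f holomorphic_on S"
    and s: "\<And>z. z \<in> ball 0 1 \<Longrightarrow> (\<lambda>n. a n * z ^ n) sums f z"
  shows "\<exists>r. r holomorphic_on S \<and> (\<forall>z\<in>S. f z = (\<Sum>j\<le>K. a j * z ^ j) + z ^ Suc K * r z)"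
proof -
  \<comment> \<open>The induction also carries the power series of the remainder, which the next
    division needs.\<close>
  have "\<exists>r. r holomorphic_on S \<and> (\<forall>z\<in>S. f z = (\<Sum>j\<le>K. a j * z ^ j) + z ^ Suc K * r z) \<and>
     (\<forall>z\<in>ball 0 1. (\<lambda>n. a (n + Suc K) * z ^ n) sums r z)"
  proof (induction K)
    case 0
    show ?case by (rule taylor_division_step[OF S f s]) auto
  next
    case (Suc K)
    then obtain r where r: "r holomorphic_on S" "\<forall>z\<in>S. f z = (\<Sum>j\<le>K. a j * z ^ j) + z ^ Suc K * r z"
      "\<And>z. z\<in>ball 0 1 \<Longrightarrow> (\<lambda>n. a (n + Suc K) * z ^ n) sums r z" by blast
    show ?case
    proof (rule taylor_division_step[OF S r(1) r(3)])
      fix q assume q: "q holomorphic_on S" "\<And>z. z \<in> S \<Longrightarrow> r z = a (0 + Suc K) + z * q z"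
        "\<And>z. z \<in> ball 0 1 \<Longrightarrow> (\<lambda>n. a (Suc n + Suc K) * z ^ n) sums q z"
      have "f z = (\<Sum>j\<le>Suc K. a j * z ^ j) + z ^ Suc (Suc K) * q z" if "z \<in> S" for z
        using r(2) q(2) that by (simp add: algebra_simps)
      then show ?thesis using q by (intro exI[of _ q]) auto
    qed
  qed
  then show ?thesis by blast
qed

lemma Omega_iff:
  assumes "\<gamma> < 1"
  shows "z \<in> Omega \<gamma> \<longleftrightarrow> cmod ((1 - \<gamma>) * z + \<gamma>) < 1"
proof -
  have "of_real (1 - \<gamma>) * complex_of_real (- \<gamma> / (1 - \<gamma>)) = of_real (- \<gamma>)"
    using assms by (simp only: of_real_mult[symmetric]) simp
  then have "(1 - \<gamma>) * z + \<gamma> = of_real (1 - \<gamma>) * (z - complex_of_real (- \<gamma> / (1 - \<gamma>)))"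
    unfolding right_diff_distrib by simp
  then have "cmod ((1 - \<gamma>) * z + \<gamma>) = (1 - \<gamma>) * cmod (z - complex_of_real (- \<gamma> / (1 - \<gamma>)))"
    using assms by (simp only: norm_mult norm_of_real)
  moreover define d where "d = cmod (z - complex_of_real (- \<gamma> / (1 - \<gamma>)))"
  moreover have "z \<in> Omega \<gamma> \<longleftrightarrow> d < 1 / (1 - \<gamma>)"
    unfolding Omega_def mem_ball dist_norm d_def by (simp only: norm_minus_commute)
  ultimately show ?thesis using assms by (simp add: pos_less_divide_eq mult.commute)
qed

lemma Omega_open: "open (Omega \<gamma>)"
  by (simp add: Omega_def)

lemma unit_ball_Omega:
  assumes "0 \<le> \<gamma>" "\<gamma> < 1"
  shows "ball 0 1 \<subseteq> Omega \<gamma>"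
proof
  fix z :: complex assume z: "z \<in> ball 0 1"
  have "cmod ((1 - \<gamma>) * z + \<gamma>) \<le> cmod (of_real (1 - \<gamma>) * z) + cmod (of_real \<gamma>)"
    using norm_triangle_ineq[of "of_real (1 - \<gamma>) * z" "of_real \<gamma>"] by simp
  also have "\<dots> = (1 - \<gamma>) * cmod z + \<gamma>" using assms by (simp only: norm_mult norm_of_real)
  also have "\<dots> < (1 - \<gamma>) * 1 + \<gamma>" using assms z by (intro add_strict_right_mono mult_strict_left_mono) auto
  finally show "z \<in> Omega \<gamma>" using Omega_iff assms by simp
qed

context
  fixes \<gamma> :: real and f :: "complex \<Rightarrow> complex" and a :: "nat \<Rightarrow> complex"
  assumes \<gamma>0: "0 \<le> \<gamma>" and \<gamma>1: "\<gamma> < 1"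
    and f_holo: "f holomorphic_on Omega \<gamma>"
    and f_bound: "\<And>z. z \<in> Omega \<gamma> \<Longrightarrow> cmod (f z) \<le> 1"
    and f_sums: "\<And>z. z \<in> ball 0 1 \<Longrightarrow> (\<lambda>n. a n * z ^ n) sums f z"
begin

text \<open>The disk bounds require holomorphy on a closed disk, while f is given on the open set
  \<open>Omega \<gamma>\<close> only. Shrinking towards z = 0 keeps a_0 and turns a_n into a_n
  t^n.\<close>

lemma coeff_bounds_dilated:
  fixes t :: real
  assumes t: "0 < t" "t < 1"
  shows "cmod (a (2 * m + 1) * of_real t ^ (2 * m + 1)) + (\<Sum>n=1..m. (cmod (a n * of_real t ^ n))\<^sup>2) \<le> (1 - (cmod (a 0))\<^sup>2) / (1 + \<gamma>)"
  "cmod (a (2 * m + 2) * of_real t ^ (2 * m + 2)) + (\<Sum>n=1..m. (cmod (a n * of_real t ^ n))\<^sup>2) + (cmod (a (m + 1) * of_real t ^ (m + 1)))\<^sup>2 / (1 + cmod (a 0))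
     \<le> (1 - (cmod (a 0))\<^sup>2) / (1 + \<gamma>)"
proof -
  define h where "h w = of_real t * disk_coord \<gamma> w" for w
  have h: "h w \<in> Omega \<gamma>" if "w \<in> cball 0 1" for w
  proof -
    \<comment> \<open>In the disk coordinate \<open>h w\<close> is the convex combination of w and
      the interior point \<open>\<gamma>\<close> with weights t and 1 - t, so its modulus is below
      1.\<close>
    have "(1 - \<gamma>) * h w + \<gamma> = of_real t * w + of_real ((1 - t) * \<gamma>)"
    proof -
      have "(1 - of_real \<gamma>) * h w = of_real t * (w - of_real \<gamma>)"
        using one_minus_nz[OF \<gamma>0 \<gamma>1] by (simp add: h_def disk_coord_def)
      then show ?thesis by (simp add: algebra_simps)
    qed
    also have "cmod \<dots> \<le> cmod (of_real t * w) + cmod (of_real ((1 - t) * \<gamma>))"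
      by (rule norm_triangle_ineq)
    also have "\<dots> = t * cmod w + (1 - t) * \<gamma>" using t \<gamma>0 by (simp only: norm_mult norm_of_real) simp
    also have "\<dots> \<le> t * 1 + (1 - t) * \<gamma>" using that t by (intro add_right_mono mult_left_mono) auto
    also have "\<dots> < t * 1 + (1 - t) * 1" using t \<gamma>1 by (intro add_strict_left_mono mult_strict_left_mono) auto
    finally show ?thesis using Omega_iff \<gamma>1 by simp
  qed
  have hh: "h holomorphic_on cball 0 1"
    unfolding h_def by (intro holomorphic_intros disk_coord_holo \<gamma>0 \<gamma>1)
  have comp: "(\<lambda>w. F (h w)) holomorphic_on cball 0 1" if "F holomorphic_on Omega \<gamma>" for F
    using holomorphic_on_compose_gen[OF hh that image_subsetI[OF h]] by (simp add: o_def)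
  have T: "\<exists>r. r holomorphic_on cball 0 1 \<and>
      (\<forall>w\<in>cball 0 1. f (h w) = (\<Sum>j\<le>K. a j * of_real t ^ j * disk_coord \<gamma> w ^ j) + disk_coord \<gamma> w ^ Suc K * r w)" for K
  proof -
    obtain r where r: "r holomorphic_on Omega \<gamma>" "\<forall>z\<in>Omega \<gamma>. f z = (\<Sum>j\<le>K. a j * z ^ j) + z ^ Suc K * r z"
      using taylor_division[OF Omega_open unit_ball_Omega[OF \<gamma>0 \<gamma>1] f_holo f_sums] by blast
    have "f (h w) = (\<Sum>j\<le>K. a j * of_real t ^ j * disk_coord \<gamma> w ^ j) + disk_coord \<gamma> w ^ Suc K * (of_real t ^ Suc K * r (h w))"
      if "w \<in> cball 0 1" for w
      using bspec[OF r(2) h[OF that]] by (simp add: h_def power_mult_distrib mult_ac)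
    moreover have "(\<lambda>w. of_real t ^ Suc K * r (h w)) holomorphic_on cball 0 1"
      by (intro holomorphic_intros comp r(1))
    ultimately show ?thesis by blast
  qed
  have "cmod (f (h w)) \<le> 1" if "w \<in> sphere 0 1" for w
    using f_bound[OF h] that by simp
  note B = coeff_bounds_disk[OF \<gamma>0 \<gamma>1 comp[OF f_holo] this T]
  from B(1)[of m] show "cmod (a (2 * m + 1) * of_real t ^ (2 * m + 1)) + (\<Sum>n=1..m. (cmod (a n * of_real t ^ n))\<^sup>2) \<le> (1 - (cmod (a 0))\<^sup>2) / (1 + \<gamma>)"
    by simp
  from B(2)[of m] show "cmod (a (2 * m + 2) * of_real t ^ (2 * m + 2)) + (\<Sum>n=1..m. (cmod (a n * of_real t ^ n))\<^sup>2) + (cmod (a (m + 1) * of_real t ^ (m + 1)))\<^sup>2 / (1 + cmod (a 0))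
     \<le> (1 - (cmod (a 0))\<^sup>2) / (1 + \<gamma>)"
    by simp
qed

text \<open>For fixed m only finitely many coefficients occur, so the dilated bounds pass to the
  limit as t tends to 1 from the left.\<close>

lemma coeff_bounds:
  "cmod (a (2 * m + 1)) + (\<Sum>n=1..m. (cmod (a n))\<^sup>2) \<le> (1 - (cmod (a 0))\<^sup>2) / (1 + \<gamma>)" (is ?A)
  "cmod (a (2 * m + 2)) + (\<Sum>n=1..m. (cmod (a n))\<^sup>2) + (cmod (a (m + 1)))\<^sup>2 / (1 + cmod (a 0))
     \<le> (1 - (cmod (a 0))\<^sup>2) / (1 + \<gamma>)" (is ?B)
proof -
  have ev: "eventually (\<lambda>t::real. 0 < t \<and> t < 1) (at_left 1)"
    using eventually_at_left_real[of 0 "1::real"] by (auto elim: eventually_mono)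
  have nz: "1 + cmod (a 0) \<noteq> 0" using norm_ge_zero[of "a 0"] by linarith
  have 1: "((\<lambda>t. cmod (a (2 * m + 1) * of_real t ^ (2 * m + 1)) + (\<Sum>n=1..m. (cmod (a n * of_real t ^ n))\<^sup>2)) \<longlongrightarrow>
     cmod (a (2 * m + 1) * of_real 1 ^ (2 * m + 1)) + (\<Sum>n=1..m. (cmod (a n * of_real 1 ^ n))\<^sup>2)) (at_left 1)"
    by (intro tendsto_intros)
  have 2: "((\<lambda>t. cmod (a (2 * m + 2) * of_real t ^ (2 * m + 2)) + (\<Sum>n=1..m. (cmod (a n * of_real t ^ n))\<^sup>2) + (cmod (a (m + 1) * of_real t ^ (m + 1)))\<^sup>2 / (1 + cmod (a 0))) \<longlongrightarrow>
     cmod (a (2 * m + 2) * of_real 1 ^ (2 * m + 2)) + (\<Sum>n=1..m. (cmod (a n * of_real 1 ^ n))\<^sup>2) + (cmod (a (m + 1) * of_real 1 ^ (m + 1)))\<^sup>2 / (1 + cmod (a 0))) (at_left 1)"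
    using nz by (intro tendsto_intros)
  show ?A
    using tendsto_upperbound[OF 1 eventually_mono[OF ev coeff_bounds_dilated(1)[of _ m]]] by simp
  show ?B
    using tendsto_upperbound[OF 2 eventually_mono[OF ev coeff_bounds_dilated(2)[of _ m]]] by simp
qed

end

section \<open>Summation of the coefficient bounds against the weights\<close>

text \<open>Weighted arithmetic-geometric mean inequality for x^2 and 1 with weights p/2 and 1 -
  p/2; p <= 2 makes the second weight nonnegative.\<close>

lemma powr_le_quadratic:
  fixes x p :: real
  assumes "0 \<le> x" "x \<le> 1" "0 < p" "p \<le> 2"
  shows "p / 2 * (1 - x\<^sup>2) \<le> 1 - x powr p"
proof (cases "x = 0")
  case True
  then show ?thesis using assms by simp
next
  case False
  then have x: "0 < x" using assms by simp
  have "x\<^sup>2 = x powr 2" using x by simp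
  then have "x\<^sup>2 powr (p / 2) = x powr p" by (simp add: powr_powr)
  moreover have "x\<^sup>2 powr (p / 2) * 1 powr (1 - p / 2) \<le> p / 2 * x\<^sup>2 + (1 - p / 2) * 1"
    using assms x by (intro Youngs_inequality_0) auto
  ultimately show ?thesis by (simp add: algebra_simps)
qed

lemma sum_le_sum_support:
  fixes F :: "nat \<Rightarrow> real"
  assumes "\<And>n. 0 \<le> F n" "\<And>n. k < n \<Longrightarrow> F n = 0"
  shows "(\<Sum>n=1..N. F n) \<le> (\<Sum>n=1..k. F n)"
proof -
  have "(\<Sum>n=1..N. F n) = (\<Sum>n\<in>{1..N} \<inter> {1..k}. F n)"
    using assms(2) by (intro sum.mono_neutral_right) auto
  also have "\<dots> \<le> (\<Sum>n=1..k. F n)"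
    using assms(1) by (intro sum_mono2) auto
  finally show ?thesis .
qed

lemma weighted_sum_bound:
  fixes c \<phi> :: "nat \<Rightarrow> real" and A P :: real
  assumes \<phi>: "\<And>n. 0 \<le> \<phi> n" "summable \<phi>"
    and c: "\<And>n. 0 \<le> c n" and A: "0 \<le> A" and P: "P \<le> 1"
    and odd: "\<And>m. c (2 * m + 1) + (\<Sum>n=1..m. (c n)\<^sup>2) \<le> P"
    and even: "\<And>m. c (2 * m + 2) + (\<Sum>n=1..m. (c n)\<^sup>2) + (c (m + 1))\<^sup>2 / (1 + A) \<le> P"
  defines "d \<equiv> \<lambda>n. c n ^ (2 * n) * (\<phi> (2 * n) / (1 + A) + (\<Sum>k. \<phi> (k + (2 * n + 1))))"
  shows "summable (\<lambda>m. c (Suc m) * \<phi> (Suc m))"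
    and "summable (\<lambda>m. d (Suc m))"
    and "(\<Sum>m. c (Suc m) * \<phi> (Suc m)) + (\<Sum>m. d (Suc m)) \<le> P * (\<Sum>m. \<phi> (Suc m))"
proof -
  have \<phi>S: "summable (\<lambda>m. \<phi> (Suc m))" using \<phi>(2) by (simp add: summable_Suc_iff)
  have cP: "c (Suc m) \<le> P" for m
  proof (cases "Parity.even m")
    case True
    then obtain j where "m = 2 * j" by (elim evenE)
    moreover have "0 \<le> (\<Sum>n=1..j. (c n)\<^sup>2)" by (simp add: sum_nonneg)
    ultimately show ?thesis using odd[of j] by simp
  next
    case False
    then obtain j where "m = 2 * j + 1" by (elim oddE)
    moreover have "0 \<le> (\<Sum>n=1..j. (c n)\<^sup>2)" "0 \<le> (c (j + 1))\<^sup>2 / (1 + A)"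
      using A by (simp_all add: sum_nonneg)
    ultimately show ?thesis using even[of j] by simp
  qed
  show sc: "summable (\<lambda>m. c (Suc m) * \<phi> (Suc m))"
    by (rule summable_comparison_test'[OF summable_mult[OF \<phi>S, of P]])
      (auto simp: abs_mult c \<phi>(1) intro!: mult_right_mono cP)
  define v where "v n = c n ^ (2 * n)" for n
  have v0: "0 \<le> v n" for n by (simp add: v_def c)
  \<comment> \<open>c_n <= P <= 1 allows the exponent 2n to be lowered to 2.\<close>
  have v: "v n \<le> (c n)\<^sup>2" if n: "1 \<le> n" for n
  proof -
    obtain k where "n = Suc k" using n by (cases n) auto
    then have "c n \<le> 1" using cP[of k] P by simp
    then show ?thesis unfolding v_def using n c by (intro power_decreasing) auto
  qed
  \<comment> \<open>The weight of \<open>v n\<close> in front of \<open>\<phi> (Suc m)\<close>: the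
    condition 2n <= m says that Suc m >= 2n + 1, the range of the tail, and m + 1 = 2n singles out
    the separate term.\<close>
  define s where "s n m = (if 2 * n \<le> m then 1 else 0) + (if m + 1 = 2 * n then 1 / (1 + A) else 0)" for n m :: nat
  have s0: "0 \<le> s n m" for n m using A by (simp add: s_def)
  have pw: "c (Suc m) + (\<Sum>n=1..N. v n * s n m) \<le> P" for m N
  proof (cases "Parity.even m")
    case True
    then obtain j where j: "m = 2 * j" by (elim evenE)
    have par: "Suc (2 * j) \<noteq> 2 * n" for n by presburger
    have "(\<Sum>n=1..N. v n * s n m) \<le> (\<Sum>n=1..j. v n * s n m)"
      by (rule sum_le_sum_support) (simp_all add: v0 s0, simp add: s_def j par)
    also have "\<dots> \<le> (\<Sum>n=1..j. (c n)\<^sup>2)"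
    proof (rule sum_mono)
      fix n assume n: "n \<in> {1..j}"
      then have "m + 1 \<noteq> 2 * n" "2 * n \<le> m" using j par by auto
      then show "v n * s n m \<le> (c n)\<^sup>2" using v[of n] n by (simp add: s_def)
    qed
    finally show ?thesis using odd[of j] j by simp
  next
    case False
    then obtain j where j: "m = 2 * j + 1" by (elim oddE)
    have "(\<Sum>n=1..N. v n * s n m) \<le> (\<Sum>n=1..Suc j. v n * s n m)"
      by (rule sum_le_sum_support) (simp_all add: v0 s0, simp add: s_def j)
    \<comment> \<open>Here m + 1 = 2 (j + 1), so the last index is the only one that carries the
      weight 1 / (1 + A).\<close>
    also have "\<dots> = (\<Sum>n=1..j. v n * s n m) + v (Suc j) * s (Suc j) m" by simp
    also have "\<dots> \<le> (\<Sum>n=1..j. (c n)\<^sup>2) + (c (Suc j))\<^sup>2 * (1 / (1 + A))"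
    proof (rule add_mono)
      show "(\<Sum>n=1..j. v n * s n m) \<le> (\<Sum>n=1..j. (c n)\<^sup>2)"
      proof (rule sum_mono)
        fix n assume n: "n \<in> {1..j}"
        then have "m + 1 \<noteq> 2 * n" "2 * n \<le> m" using j by auto
        then show "v n * s n m \<le> (c n)\<^sup>2" using v[of n] n by (simp add: s_def)
      qed
      have "s (Suc j) m = 1 / (1 + A)" by (simp add: s_def j)
      then show "v (Suc j) * s (Suc j) m \<le> (c (Suc j))\<^sup>2 * (1 / (1 + A))"
        using v[of "Suc j"] A by (simp only:) (intro mult_right_mono, auto)
    qed
    finally show ?thesis using even[of j] j by simp
  qed
  have ds: "(\<lambda>m. v n * s n m * \<phi> (Suc m)) sums d n" if n: "1 \<le> n" for n
  proof -
    have "(\<lambda>m. if m = 2 * n - 1 then \<phi> (Suc m) / (1 + A) else 0) sums (\<phi> (Suc (2 * n - 1)) / (1 + A))"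
      by (rule sums_single)
    moreover have "(\<lambda>m. if 2 * n \<le> m then \<phi> (Suc m) else 0) sums (\<Sum>k. \<phi> (k + (2 * n + 1)))"
    proof -
      have "(\<lambda>k. \<phi> (k + (2 * n + 1))) sums (\<Sum>k. \<phi> (k + (2 * n + 1)))"
        using \<phi>(2) by (intro summable_sums summable_ignore_initial_segment)
      then have "(\<lambda>k. if 2 * n \<le> k + 2 * n then \<phi> (Suc (k + 2 * n)) else 0) sums (\<Sum>k. \<phi> (k + (2 * n + 1)))"
        by simp
      then show ?thesis
        by (subst sums_zero_iff_shift[symmetric, of "2 * n"]) auto
    qed
    ultimately have "(\<lambda>m. (if m = 2 * n - 1 then \<phi> (Suc m) / (1 + A) else 0) + (if 2 * n \<le> m then \<phi> (Suc m) else 0))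
       sums (\<phi> (Suc (2 * n - 1)) / (1 + A) + (\<Sum>k. \<phi> (k + (2 * n + 1))))"
      by (rule sums_add)
    from sums_mult[OF this, of "v n"]
    have "(\<lambda>m. v n * ((if m = 2 * n - 1 then \<phi> (Suc m) / (1 + A) else 0) + (if 2 * n \<le> m then \<phi> (Suc m) else 0)))
       sums d n" using n by (simp add: d_def v_def)
    moreover have "v n * ((if m = 2 * n - 1 then \<phi> (Suc m) / (1 + A) else 0) + (if 2 * n \<le> m then \<phi> (Suc m) else 0))
      = v n * s n m * \<phi> (Suc m)" for m
    proof -
      have "m = 2 * n - 1 \<longleftrightarrow> m + 1 = 2 * n" using n by auto
      then show ?thesis by (simp add: s_def)
    qed
    ultimately show ?thesis by (simp only:)
  qed
  have d0: "0 \<le> d (Suc m)" for m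
    using sums_le[OF _ sums_zero ds[of "Suc m"]] v0 s0 \<phi>(1) by simp
  have le: "(\<Sum>m. c (Suc m) * \<phi> (Suc m)) + (\<Sum>m<N. d (Suc m)) \<le> P * (\<Sum>m. \<phi> (Suc m))" for N
  proof -
    have "(\<lambda>m. \<Sum>n=1..N. v n * s n m * \<phi> (Suc m)) sums (\<Sum>n=1..N. d n)"
      by (rule sums_sum) (use ds in auto)
    with summable_sums[OF sc]
    have "(\<lambda>m. c (Suc m) * \<phi> (Suc m) + (\<Sum>n=1..N. v n * s n m * \<phi> (Suc m))) sums
       ((\<Sum>m. c (Suc m) * \<phi> (Suc m)) + (\<Sum>n=1..N. d n))"
      by (rule sums_add)
    moreover have "(\<lambda>m. P * \<phi> (Suc m)) sums (P * (\<Sum>m. \<phi> (Suc m)))"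
      by (intro sums_mult summable_sums \<phi>S)
    moreover have "c (Suc m) * \<phi> (Suc m) + (\<Sum>n=1..N. v n * s n m * \<phi> (Suc m)) \<le> P * \<phi> (Suc m)" for m
      using mult_right_mono[OF pw[of m N] \<phi>(1)[of "Suc m"]]
      by (simp add: distrib_right sum_distrib_right)
    ultimately have "(\<Sum>m. c (Suc m) * \<phi> (Suc m)) + (\<Sum>n=1..N. d n) \<le> P * (\<Sum>m. \<phi> (Suc m))"
      by (rule sums_le[rotated 1])
    moreover have "(\<Sum>n=1..N. d n) = (\<Sum>m<N. d (Suc m))"
      by (rule sum.reindex_bij_witness[of _ Suc "\<lambda>n. n - 1"]) auto
    ultimately show ?thesis by simp
  qed
  show sd: "summable (\<lambda>m. d (Suc m))"
    by (rule summableI_nonneg_bounded[where x = "P * (\<Sum>m. \<phi> (Suc m)) - (\<Sum>m. c (Suc m) * \<phi> (Suc m))"])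
      (use d0 le in \<open>auto simp: algebra_simps\<close>)
  have "(\<Sum>m. d (Suc m)) \<le> P * (\<Sum>m. \<phi> (Suc m)) - (\<Sum>m. c (Suc m) * \<phi> (Suc m))"
    by (rule suminf_le_const[OF sd]) (use le in \<open>simp add: algebra_simps\<close>)
  then show "(\<Sum>m. c (Suc m) * \<phi> (Suc m)) + (\<Sum>m. d (Suc m)) \<le> P * (\<Sum>m. \<phi> (Suc m))"
    by simp
qed

lemma in_F_nonneg: "in_F \<phi> \<Longrightarrow> 0 \<le> r \<Longrightarrow> r < 1 \<Longrightarrow> 0 \<le> \<phi> n r"
  by (simp add: in_F_def)

text \<open>A singleton is compact, so locally uniform convergence contains pointwise convergence;
  the sums written with \<open>suminf\<close> are then genuine limits.\<close>

lemma in_F_summable: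
  assumes "in_F \<phi>" "0 \<le> r" "r < 1"
  shows "summable (\<lambda>n. \<phi> n r)"
proof -
  have "compact {r}" "{r} \<subseteq> {0..<1}" using assms by auto
  then have "uniform_limit {r} (\<lambda>N r. \<Sum>n<N. \<phi> n r) (\<lambda>r. \<Sum>n. \<phi> n r) sequentially"
    using assms(1) unfolding in_F_def by blast
  then have "(\<lambda>N. \<Sum>n<N. \<phi> n r) \<longlonglongrightarrow> (\<Sum>n. \<phi> n r)"
    by (rule tendsto_uniform_limitI) simp
  then show ?thesis by (auto simp: summable_def sums_def)
qed

section \<open>Upper and lower bounds for the functional\<close>

context
  fixes \<gamma> r :: real and f :: "complex \<Rightarrow> complex" and a :: "nat \<Rightarrow> complex"
    and \<phi> :: "nat \<Rightarrow> real \<Rightarrow> real"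
  assumes \<gamma>0: "0 \<le> \<gamma>" and \<gamma>1: "\<gamma> < 1"
    and f_holo: "f holomorphic_on Omega \<gamma>"
    and f_bound: "\<And>z. z \<in> Omega \<gamma> \<Longrightarrow> cmod (f z) \<le> 1"
    and f_sums: "\<And>z. z \<in> ball 0 1 \<Longrightarrow> (\<lambda>n. a n * z ^ n) sums f z"
    and \<phi>: "in_F \<phi>" and r: "0 \<le> r" "r < 1"
begin

lemma a0_le: "cmod (a 0) \<le> 1"
proof -
  have "f 0 = a 0" using f_sums[of 0] by (simp add: powser_sums_zero_iff)
  then show ?thesis using f_bound[of 0] subsetD[OF unit_ball_Omega[OF \<gamma>0 \<gamma>1], of 0] by simp
qed

lemma bohr_sums:
  shows "summable (\<lambda>m. cmod (a (Suc m)) * \<phi> (Suc m) r)"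
    and "0 \<le> A_fun a \<phi> r"
    and "(\<Sum>m. cmod (a (Suc m)) * \<phi> (Suc m) r) + A_fun a \<phi> r
      \<le> (1 - (cmod (a 0))\<^sup>2) / (1 + \<gamma>) * (\<Sum>m. \<phi> (Suc m) r)"
proof -
  have P: "(1 - (cmod (a 0))\<^sup>2) / (1 + \<gamma>) \<le> 1"
    using \<gamma>0 by (simp add: divide_le_eq add_increasing2)
  note \<phi>n = in_F_nonneg[OF \<phi> r] and \<phi>s = in_F_summable[OF \<phi> r]
  have odd: "cmod (a (2 * m + 1)) + (\<Sum>n=1..m. (cmod (a n))\<^sup>2) \<le> (1 - (cmod (a 0))\<^sup>2) / (1 + \<gamma>)" for m
    using coeff_bounds(1)[OF \<gamma>0 \<gamma>1 f_holo f_bound f_sums] by simp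
  have even: "cmod (a (2 * m + 2)) + (\<Sum>n=1..m. (cmod (a n))\<^sup>2) + (cmod (a (m + 1)))\<^sup>2 / (1 + cmod (a 0))
     \<le> (1 - (cmod (a 0))\<^sup>2) / (1 + \<gamma>)" for m
    using coeff_bounds(2)[OF \<gamma>0 \<gamma>1 f_holo f_bound f_sums] by simp
  note W = weighted_sum_bound[OF \<phi>n \<phi>s norm_ge_zero norm_ge_zero P odd even]
  have A: "A_fun a \<phi> r = (\<Sum>m. cmod (a (Suc m)) ^ (2 * Suc m) *
      (\<phi> (2 * Suc m) r / (1 + cmod (a 0)) + (\<Sum>k. \<phi> (k + (2 * Suc m + 1)) r)))"
    by (simp add: A_fun_def PhiT_def Let_def)
  show "summable (\<lambda>m. cmod (a (Suc m)) * \<phi> (Suc m) r)"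
    by (rule W(1))
  show "0 \<le> A_fun a \<phi> r"
    unfolding A by (rule suminf_nonneg[OF W(2)])
      (intro mult_nonneg_nonneg add_nonneg_nonneg divide_nonneg_nonneg suminf_nonneg \<phi>n
        summable_ignore_initial_segment[OF \<phi>s] zero_le_power norm_ge_zero, simp)
  show "(\<Sum>m. cmod (a (Suc m)) * \<phi> (Suc m) r) + A_fun a \<phi> r
      \<le> (1 - (cmod (a 0))\<^sup>2) / (1 + \<gamma>) * (\<Sum>m. \<phi> (Suc m) r)"
    unfolding A by (rule W(3))
qed

text \<open>The area-type term is nonnegative, so the worst case is \<Lambda> r = 1. The assumption
  \<open>maj\<close> exchanges the sum of the weights over 1 + \<open>\<gamma>\<close> for p/2 times
  \<phi>_0, leaving an inequality in |a_0| alone.\<close>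

lemma Mf_le:
  assumes p: "0 < p" "p \<le> 2" and \<Lambda>: "0 \<le> \<Lambda> r" "\<Lambda> r \<le> 1"
    and maj: "2 / p * (\<Sum>m. \<phi> (Suc m) r) \<le> (1 + \<gamma>) * \<phi> 0 r"
  shows "Mf \<Lambda> a \<phi> p r \<le> \<phi> 0 r"
proof -
  define x where "x = cmod (a 0)"
  have x: "0 \<le> x" "x \<le> 1" using a0_le by (auto simp: x_def)
  have x2: "0 \<le> 1 - x\<^sup>2" using x by (simp add: power_le_one)
  have "\<Lambda> r * A_fun a \<phi> r \<le> A_fun a \<phi> r"
    using bohr_sums(2) \<Lambda> by (simp add: mult_left_le_one_le)
  then have "Mf \<Lambda> a \<phi> p r \<le> \<phi> 0 r * x powr p + (1 - x\<^sup>2) / (1 + \<gamma>) * (\<Sum>m. \<phi> (Suc m) r)"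
    unfolding Mf_def x_def using bohr_sums(3) by linarith
  also have "\<dots> = \<phi> 0 r * x powr p + (1 - x\<^sup>2) * ((\<Sum>m. \<phi> (Suc m) r) / (1 + \<gamma>))"
    by simp
  also have "\<dots> \<le> \<phi> 0 r * x powr p + (1 - x\<^sup>2) * (p / 2 * \<phi> 0 r)"
    using maj p \<gamma>0 by (intro add_left_mono mult_left_mono x2) (simp add: field_simps)
  also have "\<dots> = \<phi> 0 r * (x powr p + p / 2 * (1 - x\<^sup>2))"
    by (simp add: field_simps)
  also have "\<dots> \<le> \<phi> 0 r * 1"
    using powr_le_quadratic[OF x p] in_F_nonneg[OF \<phi> r, of 0] by (intro mult_left_mono) auto
  finally show ?thesis by simp
qed

text \<open>For sharpness: truncating the series and discarding the \<Lambda> term loses only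
  nonnegative quantities, the series being summable by the coefficient bounds.\<close>

lemma Mf_ge:
  assumes \<Lambda>: "0 \<le> \<Lambda> r"
  shows "\<phi> 0 r * cmod (a 0) powr p + (\<Sum>m<N. cmod (a (Suc m)) * \<phi> (Suc m) r) \<le> Mf \<Lambda> a \<phi> p r"
proof -
  have "(\<Sum>m<N. cmod (a (Suc m)) * \<phi> (Suc m) r) \<le> (\<Sum>m. cmod (a (Suc m)) * \<phi> (Suc m) r)"
    using in_F_nonneg[OF \<phi> r] by (intro sum_le_suminf bohr_sums) auto
  moreover have "0 \<le> \<Lambda> r * A_fun a \<phi> r"
    using \<Lambda> bohr_sums(2) by simp
  ultimately show ?thesis by (simp add: Mf_def)
qed

end

section \<open>Sharpness\<close>

text \<open>This is (x - b) / (1 - x b), where b = z / (1 + \<open>\<gamma>\<close> -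
  \<open>\<gamma>\<close> z) is the Blaschke factor at \<open>\<gamma>\<close> evaluated at w =
  \<open>\<gamma>\<close> + (1 - \<open>\<gamma>\<close>) z.\<close>

definition extremal :: "real \<Rightarrow> real \<Rightarrow> complex \<Rightarrow> complex" where
  "extremal \<gamma> x z = (of_real (x * (1 + \<gamma>)) - of_real (1 + x * \<gamma>) * z) / (of_real (1 + \<gamma>) - of_real (\<gamma> + x) * z)"

definition extremal_coeff :: "real \<Rightarrow> real \<Rightarrow> nat \<Rightarrow> complex" where
  "extremal_coeff \<gamma> x n = (case n of 0 \<Rightarrow> of_real x
     | Suc m \<Rightarrow> - of_real ((1 - x\<^sup>2) / (1 + \<gamma>) * ((\<gamma> + x) / (1 + \<gamma>)) ^ m))"

context
  fixes \<gamma> x :: real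
  assumes \<gamma>0: "0 \<le> \<gamma>" and \<gamma>1: "\<gamma> < 1" and x: "0 < x" "x < 1"
begin

text \<open>The difference of the squared moduli factors as (1 - x^2)(1 + \<open>\<gamma>\<close>)
  times (1 - |(1 - \<open>\<gamma>\<close>) z + \<open>\<gamma>\<close>|^2) / (1 -
  \<open>\<gamma>\<close>), and the last factor is positive exactly on
  \<open>Omega \<gamma>\<close>. The strict inequality also excludes poles.\<close>

lemma extremal_num_less_denom:
  fixes z :: complex
  assumes "z \<in> Omega \<gamma>"
  shows "cmod (of_real (x * (1 + \<gamma>)) - of_real (1 + x * \<gamma>) * z) < cmod (of_real (1 + \<gamma>) - of_real (\<gamma> + x) * z)"
proof -
  define X Y where "X = Re z" and "Y = Im z"
  have "(cmod ((1 - \<gamma>) * z + \<gamma>))\<^sup>2 < 1"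
    using Omega_iff[OF \<gamma>1, of z] assms by (simp add: power_less_one_iff)
  then have "((1 - \<gamma>) * X + \<gamma>)\<^sup>2 + ((1 - \<gamma>) * Y)\<^sup>2 < 1"
    unfolding cmod_power2 X_def Y_def by simp
  then have "0 < (1 - \<gamma>) * (1 + \<gamma> - 2 * \<gamma> * X - (1 - \<gamma>) * (X\<^sup>2 + Y\<^sup>2))"
    by (simp add: power2_eq_square algebra_simps)
  then have "0 < 1 + \<gamma> - 2 * \<gamma> * X - (1 - \<gamma>) * (X\<^sup>2 + Y\<^sup>2)"
    using \<gamma>1 by (simp add: zero_less_mult_iff)
  moreover have "0 < 1 - x\<^sup>2" using x by (simp add: power_less_one_iff)
  ultimately have "0 < (1 - x\<^sup>2) * (1 + \<gamma>) * (1 + \<gamma> - 2 * \<gamma> * X - (1 - \<gamma>) * (X\<^sup>2 + Y\<^sup>2))"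
    using \<gamma>0 by simp
  also have "\<dots> = (cmod (of_real (1 + \<gamma>) - of_real (\<gamma> + x) * z))\<^sup>2 - (cmod (of_real (x * (1 + \<gamma>)) - of_real (1 + x * \<gamma>) * z))\<^sup>2"
    unfolding cmod_power2 X_def Y_def by (simp add: power2_eq_square algebra_simps)
  finally have "(cmod (of_real (x * (1 + \<gamma>)) - of_real (1 + x * \<gamma>) * z))\<^sup>2
      < (cmod (of_real (1 + \<gamma>) - of_real (\<gamma> + x) * z))\<^sup>2"
    by (rule diff_gt_0_iff_gt[THEN iffD1])
  then show ?thesis by (rule power2_less_imp_less) (rule norm_ge_zero)
qed

lemma extremal_holo: "extremal \<gamma> x holomorphic_on Omega \<gamma>"
proof -
  have "of_real (1 + \<gamma>) - of_real (\<gamma> + x) * z \<noteq> 0" if "z \<in> Omega \<gamma>" for z :: complex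
    using extremal_num_less_denom[OF that] by (metis norm_not_less_zero norm_zero)
  then show ?thesis unfolding extremal_def by (intro holomorphic_intros) auto
qed

lemma extremal_bound:
  assumes "z \<in> Omega \<gamma>"
  shows "cmod (extremal \<gamma> x z) \<le> 1"
  using extremal_num_less_denom[OF assms]
  by (simp add: extremal_def norm_divide divide_le_eq_1)

text \<open>Splitting off the value x at 0 leaves -(1 - x^2) z / ((1 + \<open>\<gamma>\<close>)(1 -
  t z)) with t = (\<open>\<gamma>\<close> + x) / (1 + \<open>\<gamma>\<close>) < 1, a geometric
  series.\<close>

lemma extremal_sums:
  assumes z: "z \<in> ball 0 1"
  shows "(\<lambda>n. extremal_coeff \<gamma> x n * z ^ n) sums extremal \<gamma> x z"
proof -
  define t where "t = (\<gamma> + x) / (1 + \<gamma>)"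
  have t: "0 \<le> t" "t < 1" "t * (1 + \<gamma>) = \<gamma> + x" using \<gamma>0 x by (auto simp: t_def)
  have "cmod (of_real t * z) < 1"
    using z t by (simp add: norm_mult) (metis abs_of_nonneg mult_less_cancel_right2 mult_strict_mono' norm_ge_zero mult.right_neutral)
  then have g: "(\<lambda>n. (of_real t * z) ^ n) sums (1 / (1 - of_real t * z))" and nz: "1 - of_real t * z \<noteq> 0"
    by (auto intro: geometric_sums)
  from sums_mult[OF g(1), of "- of_real ((1 - x\<^sup>2) / (1 + \<gamma>)) * z"]
  have "(\<lambda>n. extremal_coeff \<gamma> x (Suc n) * z ^ Suc n) sums
     (- of_real ((1 - x\<^sup>2) / (1 + \<gamma>)) * z * (1 / (1 - of_real t * z)))"
    unfolding extremal_coeff_def nat.case t_def[symmetric] of_real_mult of_real_power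
    by (simp add: power_mult_distrib mult_ac)
  then have "(\<lambda>n. extremal_coeff \<gamma> x n * z ^ n) sums
     (- of_real ((1 - x\<^sup>2) / (1 + \<gamma>)) * z * (1 / (1 - of_real t * z)) + of_real x)"
    using sums_Suc_iff[of "\<lambda>n. extremal_coeff \<gamma> x n * z ^ n"] by (simp add: extremal_coeff_def)
  moreover have "- of_real ((1 - x\<^sup>2) / (1 + \<gamma>)) * z * (1 / (1 - of_real t * z)) + of_real x = extremal \<gamma> x z"
  proof -
    have g1: "1 + of_real \<gamma> \<noteq> (0::complex)" using \<gamma>0 by (auto simp: complex_eq_iff)
    have "of_real (1 + \<gamma>) * (1 - of_real t * z) = of_real (1 + \<gamma>) - of_real (t * (1 + \<gamma>)) * z"
      by (simp add: algebra_simps)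
    then have D: "of_real (1 + \<gamma>) - of_real (\<gamma> + x) * z = of_real (1 + \<gamma>) * (1 - of_real t * z)"
      unfolding t(3) by simp
    have "x * (t * (1 + \<gamma>)) + (1 - x\<^sup>2) = 1 + x * \<gamma>"
      unfolding t(3) by (simp add: power2_eq_square algebra_simps)
    then have E: "complex_of_real (1 + x * \<gamma>) = of_real (x * (t * (1 + \<gamma>)) + (1 - x\<^sup>2))"
      by (simp only:)
    have N: "of_real (x * (1 + \<gamma>)) - of_real (1 + x * \<gamma>) * z = of_real x * (of_real (1 + \<gamma>) * (1 - of_real t * z)) - of_real (1 - x\<^sup>2) * z"
      by (subst E) (simp add: algebra_simps)
    show ?thesis unfolding extremal_def D N using nz g1 by (simp add: divide_simps)
  qed
  ultimately show ?thesis by simp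
qed

lemma norm_extremal_coeff_0: "cmod (extremal_coeff \<gamma> x 0) = x"
  using x by (simp add: extremal_coeff_def)

text \<open>The ratio (\<open>\<gamma>\<close> + x) / (1 + \<open>\<gamma>\<close>) is at least x.
  One bound for all m <= N suffices because the factor x^N tends to 1 with x.\<close>

lemma norm_extremal_coeff_Suc_ge:
  assumes "m \<le> N"
  shows "(1 - x\<^sup>2) / (1 + \<gamma>) * x ^ N \<le> cmod (extremal_coeff \<gamma> x (Suc m))"
proof -
  have x2: "0 < 1 - x\<^sup>2" using x by (simp add: power_less_one_iff)
  have t: "x \<le> (\<gamma> + x) / (1 + \<gamma>)" using mult_left_le[of x \<gamma>] \<gamma>0 x by (simp add: field_simps)
  have "x ^ N \<le> x ^ m" using x assms by (intro power_decreasing) auto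
  also have "\<dots> \<le> ((\<gamma> + x) / (1 + \<gamma>)) ^ m" using t x by (intro power_mono) auto
  finally have "(1 - x\<^sup>2) / (1 + \<gamma>) * x ^ N \<le> (1 - x\<^sup>2) / (1 + \<gamma>) * ((\<gamma> + x) / (1 + \<gamma>)) ^ m"
    using x2 \<gamma>0 by (intro mult_left_mono) auto
  also have "\<dots> = cmod (extremal_coeff \<gamma> x (Suc m))"
    using x2 \<gamma>0 x unfolding extremal_coeff_def nat.case norm_minus_cancel norm_of_real by simp
  finally show ?thesis .
qed

end

lemma Mf_extremal_greater:
  assumes \<gamma>: "0 \<le> \<gamma>" "\<gamma> < 1" and p: "0 < p"
    and \<phi>: "in_F \<phi>" and r: "0 \<le> r" "r < 1" and \<Lambda>: "0 \<le> \<Lambda> r"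
    and less: "(1 + \<gamma>) * \<phi> 0 r < 2 / p * (\<Sum>m. \<phi> (Suc m) r)"
  obtains x where "0 < x" "x < 1" "\<phi> 0 r < Mf \<Lambda> (extremal_coeff \<gamma> x) \<phi> p r"
proof -
  have "summable (\<lambda>m. \<phi> (Suc m) r)"
    using in_F_summable[OF \<phi> r] summable_Suc_iff[of "\<lambda>n. \<phi> n r"] by blast
  then have "(\<lambda>N. \<Sum>m<N. \<phi> (Suc m) r) \<longlonglongrightarrow> (\<Sum>m. \<phi> (Suc m) r)"
    by (rule summable_LIMSEQ)
  moreover have "p / 2 * ((1 + \<gamma>) * \<phi> 0 r) < (\<Sum>m. \<phi> (Suc m) r)"
    using less p by (simp add: field_simps)
  ultimately have "eventually (\<lambda>N. p / 2 * ((1 + \<gamma>) * \<phi> 0 r) < (\<Sum>m<N. \<phi> (Suc m) r)) sequentially"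
    by (rule order_tendstoD)
  \<comment> \<open>The strict inequality survives truncation, so a finite sum is enough and no
    series has to be differentiated in x.\<close>
  then obtain N where N: "p / 2 * ((1 + \<gamma>) * \<phi> 0 r) < (\<Sum>m<N. \<phi> (Suc m) r)"
    by (auto simp: eventually_sequentially)
  define S where "S = (\<Sum>m<N. \<phi> (Suc m) r)"
  \<comment> \<open>A lower bound for the functional at the extremal function with value x at 0. It
    equals \<phi>_0 at x = 1, where 1 - x^2 vanishes; its derivative there is p \<phi>_0 - 2 S / (1
    + \<open>\<gamma>\<close>), negative by the choice of N, so \<open>H\<close> exceeds \<phi>_0
    just to the left of 1.\<close>
  define H where "H x = \<phi> 0 r * x powr p + (1 - x\<^sup>2) / (1 + \<gamma>) * x ^ N * S" for x
  have "DERIV H 1 :> \<phi> 0 r * p - 2 / (1 + \<gamma>) * S"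
    unfolding H_def using \<gamma> by (auto intro!: derivative_eq_intros)
  moreover have "\<phi> 0 r * p - 2 / (1 + \<gamma>) * S < 0"
    using N \<gamma> unfolding S_def[symmetric] by (simp add: field_simps)
  ultimately obtain d where d: "0 < d" "\<And>h. 0 < h \<Longrightarrow> h < d \<Longrightarrow> H 1 < H (1 - h)"
    using DERIV_neg_dec_left by blast
  define x where "x = 1 - min (d / 2) (1 / 2)"
  have x: "0 < x" "x < 1" using d(1) by (auto simp: x_def)
  have "H 1 < H x" unfolding x_def using d(1) by (intro d(2)) auto
  then have "\<phi> 0 r < H x" by (simp add: H_def)
  also have "H x \<le> \<phi> 0 r * cmod (extremal_coeff \<gamma> x 0) powr p
      + (\<Sum>m<N. cmod (extremal_coeff \<gamma> x (Suc m)) * \<phi> (Suc m) r)"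
    unfolding H_def S_def sum_distrib_left norm_extremal_coeff_0[OF \<gamma> x]
    by (intro add_left_mono sum_mono mult_right_mono norm_extremal_coeff_Suc_ge[OF \<gamma> x] in_F_nonneg[OF \<phi> r]) auto
  also have "\<dots> \<le> Mf \<Lambda> (extremal_coeff \<gamma> x) \<phi> p r"
    by (rule Mf_ge[where r = r and \<Lambda> = \<Lambda> and \<phi> = \<phi>, OF \<gamma> extremal_holo[OF \<gamma> x] extremal_bound[OF \<gamma> x] extremal_sums[OF \<gamma> x] \<phi> r \<Lambda>])
  finally show thesis using that x by blast
qed

theorem theorem2p1:
  fixes \<gamma> p R :: real and \<Lambda> :: "real \<Rightarrow> real" and \<phi> :: "nat \<Rightarrow> real \<Rightarrow> real"
    and f :: "complex \<Rightarrow> complex" and a :: "nat \<Rightarrow> complex"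
  assumes "0 \<le> \<gamma>" "\<gamma> < 1" "0 < p" "p \<le> 2"
    and "\<forall>r\<in>{0..1}. \<Lambda> r \<in> {0..1}"
    and "in_F \<phi>"
    and "0 < R" "R < 1"
    and "(2 / p) * (\<Sum>m. \<phi> (Suc m) R) = (1 + \<gamma>) * \<phi> 0 R"
    and "\<forall>r\<in>{0..<R}. (1 + \<gamma>) * \<phi> 0 r > (2 / p) * (\<Sum>m. \<phi> (Suc m) r)"
    and "f holomorphic_on Omega \<gamma>"
    and "\<forall>z\<in>Omega \<gamma>. norm (f z) \<le> 1"
    and "\<forall>z\<in>ball 0 1. (\<lambda>n. a n * z ^ n) sums f z"
  shows "(\<forall>r\<in>{0..R}. Mf \<Lambda> a \<phi> p r \<le> \<phi> 0 r) \<and>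
    (\<forall>\<epsilon>>0. (\<forall>r\<in>{R<..<R+\<epsilon>}. r < 1 \<longrightarrow>
                 (1 + \<gamma>) * \<phi> 0 r < (2 / p) * (\<Sum>m. \<phi> (Suc m) r)) \<longrightarrow>
       (\<forall>r\<in>{R<..<R+\<epsilon>}. r < 1 \<longrightarrow>
          (\<exists>g :: complex \<Rightarrow> complex. \<exists>b :: nat \<Rightarrow> complex.
             g holomorphic_on Omega \<gamma> \<and> (\<forall>z\<in>Omega \<gamma>. norm (g z) \<le> 1) \<and>
             (\<forall>z\<in>ball 0 1. (\<lambda>n. b n * z ^ n) sums g z) \<and>
             Mf \<Lambda> b \<phi> p r > \<phi> 0 r)))"
proof (intro conjI ballI allI impI)
  fix r assume r: "r \<in> {0..R}"
  then have r': "0 \<le> r" "r < 1" using assms by auto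
  have \<Lambda>: "0 \<le> \<Lambda> r" "\<Lambda> r \<le> 1" using assms(5) r' by auto
  have "2 / p * (\<Sum>m. \<phi> (Suc m) r) \<le> (1 + \<gamma>) * \<phi> 0 r"
  proof (cases "r = R")
    case True
    then show ?thesis using assms(9) by simp
  next
    case False
    then show ?thesis using assms(10) r by (simp add: less_imp_le)
  qed
  moreover have "cmod (f z) \<le> 1" if "z \<in> Omega \<gamma>" for z using assms(12) that by blast
  moreover have "(\<lambda>n. a n * z ^ n) sums f z" if "z \<in> ball 0 1" for z using assms(13) that by blast
  ultimately show "Mf \<Lambda> a \<phi> p r \<le> \<phi> 0 r"
    by (intro Mf_le[where f = f and \<gamma> = \<gamma>] assms(1-4,6,11) r' \<Lambda>)
next
  fix \<epsilon> r :: real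
  assume less: "\<forall>r\<in>{R<..<R+\<epsilon>}. r < 1 \<longrightarrow> (1 + \<gamma>) * \<phi> 0 r < (2 / p) * (\<Sum>m. \<phi> (Suc m) r)"
    and r: "r \<in> {R<..<R+\<epsilon>}" "r < 1"
  then have r0: "0 \<le> r" and \<Lambda>: "0 \<le> \<Lambda> r" using assms by auto
  obtain x where x: "0 < x" "x < 1" "\<phi> 0 r < Mf \<Lambda> (extremal_coeff \<gamma> x) \<phi> p r"
    using Mf_extremal_greater[where r = r and \<Lambda> = \<Lambda> and \<phi> = \<phi>, OF assms(1,2,3,6) r0 r(2) \<Lambda>] less r by blast
  then show "\<exists>g :: complex \<Rightarrow> complex. \<exists>b :: nat \<Rightarrow> complex.
             g holomorphic_on Omega \<gamma> \<and> (\<forall>z\<in>Omega \<gamma>. norm (g z) \<le> 1) \<and>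
             (\<forall>z\<in>ball 0 1. (\<lambda>n. b n * z ^ n) sums g z) \<and>
             Mf \<Lambda> b \<phi> p r > \<phi> 0 r"
    by (intro exI[of _ "extremal \<gamma> x"] exI[of _ "extremal_coeff \<gamma> x"] conjI ballI
      extremal_holo extremal_bound extremal_sums assms(1,2))
qed

end
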